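(* Let $X$ be a real Banach space with the Radon–Nikodým Property. Then $X^*$ has the w*-MIP if and only if every w*-compact convex set in $X^*$ is the w*-closed convex hull of its farthest points, i.e. $K = \overline{\mathrm{co}}^{\,w^*}(b(K))$ for every w*-compact convex set $K\subseteq X^*$.
   Context: All Banach spaces are real, and all sets $K$ considered are nonempty. $X^*$ carries the dual norm; w* denotes the weak* topology $\sigma(X^*,X)$, and $\overline{\mathrm{co}}^{\,w^*}(A)$ is the w*-closure of the convex hull of $A$. The dual $X^*$ has the w*-MIP if every bounded, w*-closed convex set in $X^*$ is admissible, i.e. is the intersection of all closed (norm) balls of $X^*$ containing it. For a norm-closed and bounded set $K\subseteq X^*$ and $x\in X^*$, put $r_K(x) = \sup\{\|z-x\| : z\in K\}$ and $Q_K(x) = \{z\in K : \|z-x\| = r_K(x)\}$. The set of farthest points of $K$ is $b(K) = \bigcup_{x\in X^*} Q_K(x)$. *)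

theory Defs
  imports "HOL-Analysis.Analysis"
begin

text \<open>
  The library's \<open>has_bochner_integral\<close> requires a second countable range type, hence would
  exclude nonseparable spaces. This is the same definition without that restriction; the
  \<open>L\<^sup>1\<close> approximation by simple functions forces \<open>f\<close> to be almost everywhere separably valued.
\<close>

definition bochner_integral_of :: "'w measure \<Rightarrow> ('w \<Rightarrow> 'a::banach) \<Rightarrow> 'a \<Rightarrow> bool" where
  "bochner_integral_of M f v \<longleftrightarrow>
     f \<in> borel_measurable M \<and>
     (\<exists>s. (\<forall>i. Bochner_Integration.simple_bochner_integrable M (s i)) \<and>
          (\<lambda>i. \<integral>\<^sup>+x. ennreal (norm (f x - s i x)) \<partial>M) \<longlonglongrightarrow> 0 \<and>
          (\<lambda>i. Bochner_Integration.simple_bochner_integral M (s i)) \<longlonglongrightarrow> v)"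

definition vector_measure :: "'w measure \<Rightarrow> ('w set \<Rightarrow> 'a::banach) \<Rightarrow> bool" where
  "vector_measure M G \<longleftrightarrow>
     (\<forall>A :: nat \<Rightarrow> 'w set. range A \<subseteq> sets M \<longrightarrow> disjoint_family A \<longrightarrow>
        (\<lambda>n. G (A n)) sums G (\<Union>n. A n))"

definition bounded_variation_measure :: "'w measure \<Rightarrow> ('w set \<Rightarrow> 'a::banach) \<Rightarrow> bool" where
  "bounded_variation_measure M G \<longleftrightarrow>
     (\<exists>B. \<forall>P. finite P \<longrightarrow> P \<subseteq> sets M \<longrightarrow> partition_on (space M) P \<longrightarrow>
        (\<Sum>E\<in>P. norm (G E)) \<le> B)"

text \<open>
  For a countably additive \<open>G\<close> and a finite measure, vanishing on null sets is equivalent to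
  \<open>G E \<rightarrow> 0\<close> as the measure of \<open>E\<close> tends to \<open>0\<close>.
\<close>

definition RNP_wrt :: "'w measure \<Rightarrow> 'a::banach itself \<Rightarrow> bool" where
  "RNP_wrt M _ \<longleftrightarrow>
     (\<forall>G :: 'w set \<Rightarrow> 'a.
        vector_measure M G \<longrightarrow> bounded_variation_measure M G \<longrightarrow>
        (\<forall>E\<in>null_sets M. G E = 0) \<longrightarrow>
        (\<exists>g. \<forall>E\<in>sets M. bochner_integral_of M (\<lambda>x. indicator E x *\<^sub>R g x) (G E)))"

text \<open>
  A definition cannot quantify over all types of underlying points, so the finite measure
  spaces range over all measures (on arbitrary sets and \<open>\<sigma>\<close>-algebras) with points in the reals.
  This includes Lebesgue measure on \<open>[0,1]\<close>, for which the property is already equivalent to the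
  property for all finite measure spaces; as a hypothesis it is in any case no stronger.
\<close>

definition radon_nikodym_property :: "'a::banach itself \<Rightarrow> bool" where
  "radon_nikodym_property T \<longleftrightarrow> (\<forall>M :: real measure. finite_measure M \<longrightarrow> RNP_wrt M T)"

text \<open>
  The dual of \<open>'a\<close> is \<open>'a \<Rightarrow>\<^sub>L real\<close>, whose norm is the dual (operator) norm. On functionals, the
  strong operator topology is the topology of pointwise convergence, i.e. the weak* topology.
\<close>

type_synonym 'a dual = "'a \<Rightarrow>\<^sub>L real"

abbreviation weak_star :: "('a::real_normed_vector \<Rightarrow>\<^sub>L real) topology" where
  "weak_star \<equiv> strong_operator_topology"

definition admissible :: "'b::real_normed_vector set \<Rightarrow> bool" where
  "admissible K \<longleftrightarrow> K = \<Inter>{cball x r | x r. r > 0 \<and> K \<subseteq> cball x r}"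

definition weak_star_MIP :: "'a::banach itself \<Rightarrow> bool" where
  "weak_star_MIP _ \<longleftrightarrow>
     (\<forall>K :: 'a dual set.
        K \<noteq> {} \<longrightarrow> bounded K \<longrightarrow> closedin weak_star K \<longrightarrow> convex K \<longrightarrow> admissible K)"

text \<open>
  The supremum is only meaningful for nonempty bounded \<open>K\<close>; weak* compact subsets of the dual of
  a Banach space are bounded.
\<close>

definition farthest_radius :: "'b::real_normed_vector set \<Rightarrow> 'b \<Rightarrow> real" where
  "farthest_radius K x = (SUP z\<in>K. norm (z - x))"

definition farthest_points_from :: "'b::real_normed_vector set \<Rightarrow> 'b \<Rightarrow> 'b set" where
  "farthest_points_from K x = {z \<in> K. norm (z - x) = farthest_radius K x}"

definition farthest_points :: "'b::real_normed_vector set \<Rightarrow> 'b set" where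
  "farthest_points K = (\<Union>x. farthest_points_from K x)"

end

theory Submission
  imports Defs
begin

text \<open>
  If every weak* compact convex set is generated by its farthest points and \<open>a \<notin> K\<close>, thicken \<open>K\<close> to
  \<open>L = K + eB\<close> with \<open>a \<notin> L\<close>. Some farthest point of \<open>co (L \<union> {a})\<close> lies outside \<open>L\<close>, which forces \<open>a\<close>
  itself to be farthest from some \<open>x\<close>; then \<open>\<parallel>k - x\<parallel> + e \<le> \<parallel>a - x\<parallel>\<close> on \<open>K\<close>, and a ball around \<open>x\<close> separates.

  Conversely, if the points having a farthest point in \<open>K\<close> are dense, then a ball containing all
  farthest points of \<open>K\<close> but missing some \<open>z \<in> K\<close> leads to a contradiction by moving its centre
  slightly. Density is Stegall's variational principle for \<open>\<phi> f = sup\<^sub>z\<^sub>\<in>\<^sub>K (- z f)\<close> on the unit ball of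
  \<open>X\<close>: where \<open>\<phi> + x\<close> attains its maximum at \<open>f\<close>, a minimizer \<open>z\<close> of \<open>z f\<close> over \<open>K\<close> is farthest from \<open>x\<close>.

  By Baire's theorem it suffices that small perturbations of \<open>\<phi>\<close> have small slices. Otherwise a
  Hahn--Banach argument shows that every point \<open>f\<close> is approximately an average of points \<open>g\<^sub>i\<close> with
  \<open>\<parallel>g\<^sub>i - f\<parallel> \<ge> \<epsilon>\<close>, where the error of the average is paid for by an increase of the average of \<open>\<phi>\<close>.
  Iterating gives a bounded quasi-martingale on \<open>[0,1)\<close> whose total drift is finite because \<open>\<phi>\<close> is
  bounded above, and whose increments have norm at least \<open>\<epsilon>\<close>. The Radon--Nikodym density of its limit
  measure is its \<open>L\<^sup>1\<close> limit, a contradiction.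
\<close>

section \<open>Additive minorants\<close>

text \<open>
  Hahn--Banach in a form that needs neither convex combinations nor homogeneity: a minimal
  subadditive function below \<open>p\<close> is additive, since for every \<open>y\<close> the function
  \<open>x \<mapsto> inf\<^sub>n (m (x + n y) - n m y)\<close> is again subadditive and below \<open>m\<close>.
\<close>

lemma subadditive_dominates_additive:
  fixes p :: "'a::real_vector \<Rightarrow> real"
  assumes p: "\<And>x y. p (x + y) \<le> p x + p y"
  obtains l where "\<And>x y. l (x + y) = l x + l y" "\<And>x. l x \<le> p x"
proof -
  define A where "A = {q :: 'a \<Rightarrow> real. (\<forall>x y. q (x + y) \<le> q x + q y) \<and> q \<le> p}"
  have AD: "q (x + y) \<le> q x + q y" "q x \<le> p x" if "q \<in> A" for q x y
    using that by (auto simp: A_def le_fun_def)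
  \<comment> \<open>This uniform lower bound keeps pointwise infima over chains finite.\<close>
  have low: "q x \<ge> - p (- x)" if "q \<in> A" for q x
    using AD(1)[OF that, of 0 0] AD(1)[OF that, of x "- x"] AD(2)[OF that, of "- x"] by simp
  have "\<exists>m\<in>A. \<forall>q\<in>A. q \<le> m \<longrightarrow> q = m"
  proof (rule predicate_Zorn[where P = "\<lambda>q q'. q' \<le> q"])
    show "partial_order_on A (relation_of (\<lambda>q q'. q' \<le> q) A)"
      by (rule partial_order_on_relation_ofI) auto
    fix C assume "C \<in> Chains (relation_of (\<lambda>q q'. q' \<le> q) A)"
    then have CA: "C \<subseteq> A" and C: "\<And>q q'. q \<in> C \<Longrightarrow> q' \<in> C \<Longrightarrow> q \<le> q' \<or> q' \<le> q"
      by (auto simp: Chains_def relation_of_def)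
    show "\<exists>u\<in>A. \<forall>q\<in>C. u \<le> q"
    proof (cases "C = {}")
      case True
      then show ?thesis using p by (intro bexI[of _ p]) (auto simp: A_def)
    next
      case False
      define u where "u x = (INF q\<in>C. q x)" for x
      have bdd: "bdd_below ((\<lambda>q. q x) ` C)" for x
        using low CA by (intro bdd_belowI2) blast
      have ule: "u x \<le> q x" if "q \<in> C" for q x
        unfolding u_def using bdd that by (rule cINF_lower)
      have sub: "u (x + y) \<le> u x + u y" for x y
      proof -
        have "u (x + y) \<le> q x + q' y" if q: "q \<in> C" and q': "q' \<in> C" for q q'
        proof -
          \<comment> \<open>A chain has a member below both \<open>q\<close> and \<open>q'\<close>,
            so a single subadditivity estimate serves both arguments.\<close>
          obtain r where r: "r \<in> C" "r \<le> q" "r \<le> q'" using C[OF q q'] q q' by blast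
          have "u (x + y) \<le> r x + r y"
            using ule[OF r(1), of "x + y"] AD(1)[of r x y] r CA by fastforce
          also have "\<dots> \<le> q x + q' y" using r by (auto simp: le_fun_def add_mono)
          finally show ?thesis .
        qed
        then have "u (x + y) - q' y \<le> u x" if "q' \<in> C" for q'
          unfolding u_def[of x] using False that by (intro cINF_greatest) (auto simp: diff_le_eq)
        then have "u (x + y) - u x \<le> u y"
          unfolding u_def[of y] using False by (intro cINF_greatest) (auto simp: diff_le_eq add.commute)
        then show ?thesis by simp
      qed
      obtain q0 where q0: "q0 \<in> C" using False by blast
      have "u x \<le> p x" for x
        using ule[OF q0, of x] AD(2)[of q0 x] q0 CA by auto
      then have "u \<le> p" by (simp add: le_fun_def)
      with sub ule show ?thesis by (intro bexI[of _ u]) (auto simp: A_def le_fun_def)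
    qed
  qed
  then obtain m where m: "m \<in> A" and min: "\<And>q. q \<in> A \<Longrightarrow> q \<le> m \<Longrightarrow> q = m" by blast
  \<comment> \<open>Minimality is used twice: for \<open>m (n x) / n\<close>, which gives
    homogeneity, and then for the infimum \<open>q\<close>, whose lower bound rests on that
    homogeneity.\<close>
  have minI: "q = m" if "\<And>x y. q (x + y) \<le> q x + q y" "\<And>x. q x \<le> m x" for q
  proof (rule min)
    have "q x \<le> p x" for x using that(2)[of x] AD(2)[OF m, of x] by linarith
    then show "q \<in> A" using that(1) by (simp add: A_def le_fun_def)
  qed (simp add: le_fun_def that)
  have sub_n: "m (real n *\<^sub>R x) \<le> real n * m x" if "n \<ge> 1" for n x
    using that
  proof (induction n rule: dec_induct)
    case (step n)
    have "m (real (Suc n) *\<^sub>R x) \<le> m (real n *\<^sub>R x) + m x"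
      using AD(1)[OF m, of "real n *\<^sub>R x" x] by (simp add: scaleR_add_left add.commute)
    with step show ?case by (simp add: algebra_simps)
  qed simp
  have hom: "m (real n *\<^sub>R x) = real n * m x" if n: "n \<ge> 1" for n x
  proof -
    have "(\<lambda>x. m (real n *\<^sub>R x) / real n) = m"
    proof (rule minI)
      show "m (real n *\<^sub>R (x + y)) / real n \<le> m (real n *\<^sub>R x) / real n + m (real n *\<^sub>R y) / real n" for x y
        using AD(1)[OF m, of "real n *\<^sub>R x" "real n *\<^sub>R y"] n
        by (simp add: scaleR_add_right add_divide_distrib[symmetric] divide_right_mono)
      show "m (real n *\<^sub>R x) / real n \<le> m x" for x
        using sub_n[OF n, of x] n by (simp add: divide_le_eq mult.commute)
    qed
    from fun_cong[OF this, of x] show ?thesis using n by (simp add: field_simps)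
  qed
  have "m (x + y) = m x + m y" for x y
  proof -
    define q where "q x = (INF n. m (x + real n *\<^sub>R y) - real n * m y)" for x
    have lb: "m (x + real n *\<^sub>R y) - real n * m y \<ge> - m (- x)" for x n
    proof (cases "n = 0")
      case True
      then show ?thesis using AD(1)[OF m, of 0 0] AD(1)[OF m, of x "- x"] by simp
    next
      case False
      then show ?thesis
        using AD(1)[OF m, of "x + real n *\<^sub>R y" "- x"] hom[of n y] by simp
    qed
    have bdd: "bdd_below (range (\<lambda>n. m (x + real n *\<^sub>R y) - real n * m y))" for x
      using lb by (intro bdd_belowI2) blast
    have qle: "q x \<le> m (x + real n *\<^sub>R y) - real n * m y" for x n
      unfolding q_def by (rule cINF_lower[OF bdd]) simp
    have "q = m"
    proof (rule minI)
      show "q x \<le> m x" for x using qle[of x 0] by simp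
      show "q (x + x') \<le> q x + q x'" for x x'
      proof -
        have *: "q (x + x') \<le> (m (x + real k *\<^sub>R y) - real k * m y)
          + (m (x' + real n *\<^sub>R y) - real n * m y)" for k n
          using qle[of "x + x'" "k + n"] AD(1)[OF m, of "x + real k *\<^sub>R y" "x' + real n *\<^sub>R y"]
          by (simp add: algebra_simps)
        have "q (x + x') - (m (x' + real n *\<^sub>R y) - real n * m y) \<le> q x" for n
          unfolding q_def[of x] using * by (intro cINF_greatest) (auto simp: diff_le_eq)
        then have "q (x + x') - q x \<le> q x'"
          unfolding q_def[of x'] by (intro cINF_greatest) (auto simp: diff_le_eq algebra_simps)
        then show ?thesis by simp
      qed
    qed
    \<comment> \<open>The term \<open>n = 1\<close> of the infimum gives
      \<open>m x \<le> m (x + y) - m y\<close>, the missing superadditivity.\<close>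
    then show ?thesis using qle[of x 1] AD(1)[OF m, of x y] by simp
  qed
  with that AD(2)[OF m] show ?thesis by blast
qed

text \<open>Real homogeneity is the point. The defect \<open>h\<close> is additive in the scalar and
  vanishes on integers, so it depends only on fractional parts and is bounded; a bounded additive
  function on the reals is zero.\<close>

lemma additive_bounded_imp_bounded_linear:
  fixes l :: "'a::real_normed_vector \<Rightarrow> real"
  assumes add: "\<And>x y. l (x + y) = l x + l y" and bound: "\<And>x. \<bar>l x\<bar> \<le> norm x * K"
  shows "bounded_linear l"
proof (rule bounded_linear_intro[OF add _ , where K = K])
  have zero: "l 0 = 0" using add[of 0 0] by simp
  have minus: "l (- x) = - l x" for x using add[of x "- x"] zero by simp
  have nat: "l (real n *\<^sub>R x) = real n * l x" for n x
    by (induction n) (simp_all add: zero add algebra_simps)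
  have int: "l (real_of_int k *\<^sub>R x) = real_of_int k * l x" for k x
    using nat[of _ x] minus by (cases k rule: int_cases2) (simp_all add: minus)
  show "l (r *\<^sub>R x) = r *\<^sub>R l x" for r x
  proof -
    define h where "h r = l (r *\<^sub>R x) - r * l x" for r
    have hadd: "h (r + s) = h r + h s" for r s
      by (simp add: h_def add algebra_simps)
    define B where "B = norm x * K + \<bar>l x\<bar>"
    have "B \<ge> 0" unfolding B_def using bound[of x] by linarith
    have hb: "\<bar>h t\<bar> \<le> B" for t
    proof -
      have "h t = h (frac t)"
        using hadd[of "of_int \<lfloor>t\<rfloor>" "frac t"] by (simp add: h_def int frac_def)
      also have "\<bar>h (frac t)\<bar> \<le> \<bar>l (frac t *\<^sub>R x)\<bar> + \<bar>frac t * l x\<bar>" by (simp add: h_def)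
      also have "\<bar>l (frac t *\<^sub>R x)\<bar> \<le> frac t * (norm x * K)"
        using bound[of "frac t *\<^sub>R x"] by (simp add: frac_ge_0)
      also have "\<bar>frac t * l x\<bar> = frac t * \<bar>l x\<bar>" by (simp add: abs_mult)
      also have "frac t * (norm x * K) + frac t * \<bar>l x\<bar> = frac t * B"
        by (simp add: B_def algebra_simps)
      also have "\<dots> \<le> 1 * B"
        by (rule mult_right_mono) (use frac_lt_1[of t] \<open>B \<ge> 0\<close> in auto)
      finally show ?thesis by simp
    qed
    have "real n * \<bar>h r\<bar> \<le> B" for n
    proof -
      have "h (real n * r) = real n * h r"
        by (induction n) (simp_all add: hadd algebra_simps, simp add: h_def zero)
      then show ?thesis using hb[of "real n * r"] by (simp add: abs_mult)
    qed
    then have "\<not> 0 < \<bar>h r\<bar>" using reals_Archimedean3[of "\<bar>h r\<bar>"] by (meson not_le)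
    then have "h r = 0" by simp
    then show ?thesis by (simp add: h_def)
  qed
  show "norm (l x) \<le> norm x * K" for x using bound by simp
qed

text \<open>
  If no list in \<open>D\<close> spreads, the functional \<open>y\<close> is an additive minorant of
  \<open>p h = inf (\<delta> \<parallel>h - \<Sum>(g - f)\<parallel> - \<Sum>(\<phi> g - \<phi> f + \<eta>))\<close>, the infimum over lists in \<open>D\<close>; subadditivity
  of \<open>p\<close> is concatenation of lists.
\<close>

lemma tilted_drop_or_spread:
  fixes \<phi> :: "'a::real_normed_vector \<Rightarrow> real"
  assumes "\<delta> \<ge> 0"
  shows "(\<exists>y :: 'a \<Rightarrow>\<^sub>L real. norm y \<le> \<delta> \<and> (\<forall>g\<in>D. \<phi> g + blinfun_apply y g \<le> \<phi> f + blinfun_apply y f - \<eta>))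
    \<or> (\<exists>gs. set gs \<subseteq> D \<and> gs \<noteq> [] \<and> (\<Sum>g\<leftarrow>gs. \<phi> g - \<phi> f + \<eta>) > \<delta> * norm (\<Sum>g\<leftarrow>gs. g - f))"
proof (rule disjCI)
  assume "\<nexists>gs. set gs \<subseteq> D \<and> gs \<noteq> [] \<and> (\<Sum>g\<leftarrow>gs. \<phi> g - \<phi> f + \<eta>) > \<delta> * norm (\<Sum>g\<leftarrow>gs. g - f)"
  then have H: "(\<Sum>g\<leftarrow>gs. \<phi> g - \<phi> f + \<eta>) \<le> \<delta> * norm (\<Sum>g\<leftarrow>gs. g - f)" if "set gs \<subseteq> D" for gs
    using that by (cases "gs = []") (auto simp: not_less)
  define c where "c g = \<phi> g - \<phi> f + \<eta>" for g
  define L where "L = {gs. set gs \<subseteq> D}"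
  define P where "P h gs = \<delta> * norm (h - (\<Sum>g\<leftarrow>gs. g - f)) - (\<Sum>g\<leftarrow>gs. c g)" for h gs
  define p where "p h = (INF gs\<in>L. P h gs)" for h
  have Pge: "P h gs \<ge> - (\<delta> * norm h)" if "gs \<in> L" for h gs
  proof -
    have "norm (\<Sum>g\<leftarrow>gs. g - f) \<le> norm h + norm (h - (\<Sum>g\<leftarrow>gs. g - f))"
      using norm_triangle_ineq4[of h "h - (\<Sum>g\<leftarrow>gs. g - f)"] by simp
    then have "\<delta> * norm (\<Sum>g\<leftarrow>gs. g - f) \<le> \<delta> * norm h + \<delta> * norm (h - (\<Sum>g\<leftarrow>gs. g - f))"
      using mult_left_mono[OF _ assms] by (simp flip: distrib_left)
    with H[of gs] that show ?thesis by (simp add: P_def c_def L_def)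
  qed
  have bdd: "bdd_below (P h ` L)" for h using Pge by (intro bdd_belowI2) blast
  have ple: "p h \<le> P h gs" if "gs \<in> L" for h gs
    unfolding p_def using bdd that by (rule cINF_lower)
  have Lne: "L \<noteq> {}" by (auto simp: L_def intro: exI[of _ "[]"])
  have "p (h + h') \<le> p h + p h'" for h h'
  proof -
    have *: "p (h + h') \<le> P h gs + P h' gs'" if "gs \<in> L" "gs' \<in> L" for gs gs'
    proof -
      have "p (h + h') \<le> P (h + h') (gs @ gs')" using that by (intro ple) (auto simp: L_def)
      also have "\<dots> \<le> P h gs + P h' gs'"
      proof -
        have "norm ((h + h') - ((\<Sum>g\<leftarrow>gs. g - f) + (\<Sum>g\<leftarrow>gs'. g - f))) \<le>
          norm (h - (\<Sum>g\<leftarrow>gs. g - f)) + norm (h' - (\<Sum>g\<leftarrow>gs'. g - f))"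
          by (simp only: add_diff_add norm_triangle_ineq)
        from mult_left_mono[OF this assms] show ?thesis by (simp add: P_def distrib_left)
      qed
      finally show ?thesis .
    qed
    have "p (h + h') - P h' gs' \<le> p h" if "gs' \<in> L" for gs'
      unfolding p_def[of h] using Lne that * by (intro cINF_greatest) (auto simp: diff_le_eq)
    then have "p (h + h') - p h \<le> p h'"
      unfolding p_def[of h'] using Lne by (intro cINF_greatest) (auto simp: diff_le_eq algebra_simps)
    then show ?thesis by simp
  qed
  then obtain l where l: "\<And>x y. l (x + y) = l x + l y" and lp: "\<And>x. l x \<le> p x"
    using subadditive_dominates_additive by blast
  \<comment> \<open>The empty list bounds \<open>l\<close> by \<delta> times the norm; the
    one-element list \<open>[g]\<close> below yields the drop at \<open>g\<close>.\<close>
  have "l x \<le> \<delta> * norm x" for x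
    using lp[of x] ple[of "[]" x] by (simp add: L_def P_def)
  moreover have "l (- x) = - l x" for x using l[of x "- x"] l[of 0 0] by simp
  ultimately have lb: "\<bar>l x\<bar> \<le> norm x * \<delta>" for x
    unfolding abs_le_iff by (metis mult.commute norm_minus_cancel)
  define y where "y = Blinfun l"
  have y: "blinfun_apply y = l"
    unfolding y_def by (rule bounded_linear_Blinfun_apply) (rule additive_bounded_imp_bounded_linear[OF l lb])
  have "norm y \<le> \<delta>"
    using assms lb by (intro norm_blinfun_bound) (auto simp: y mult.commute)
  moreover have "\<phi> g + blinfun_apply y g \<le> \<phi> f + blinfun_apply y f - \<eta>" if "g \<in> D" for g
  proof -
    have "l (g - f) \<le> - c g"
      using lp[of "g - f"] ple[of "[g]" "g - f"] that by (simp add: L_def P_def)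
    moreover have "l g = l (g - f) + l f" using l[of "g - f" f] by simp
    ultimately show ?thesis by (simp add: y c_def)
  qed
  ultimately show "\<exists>y :: 'a \<Rightarrow>\<^sub>L real. norm y \<le> \<delta> \<and> (\<forall>g\<in>D. \<phi> g + blinfun_apply y g \<le> \<phi> f + blinfun_apply y f - \<eta>)" by blast
qed

section \<open>Bochner integrals and step functions\<close>

text \<open>The range need not be second countable, so differences of Borel functions need not be
  measurable in general. Here \<open>s\<close> has finitely many values, and on each of its fibres
  the difference is a translate of \<open>f\<close>.\<close>

lemma borel_measurable_diff_simple_function:
  fixes f s :: "'w \<Rightarrow> 'a::real_normed_vector"
  assumes f: "f \<in> borel_measurable M" and s: "simple_function M s"
  shows "(\<lambda>x. f x - s x) \<in> borel_measurable M"
proof (rule borel_measurableI)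
  fix U :: "'a set" assume "open U"
  have "(\<lambda>x. f x - s x) -` U \<inter> space M =
    (\<Union>y\<in>s ` space M. (f -` ((\<lambda>z. z - y) -` U) \<inter> space M) \<inter> (s -` {y} \<inter> space M))"
    by auto
  moreover have "f -` ((\<lambda>z. z - y) -` U) \<inter> space M \<in> sets M" for y
    using \<open>open U\<close> by (intro measurable_sets[OF f] borel_open open_vimage) (auto intro!: continuous_intros)
  moreover have "finite (s ` space M)" "\<And>y. y \<in> s ` space M \<Longrightarrow> s -` {y} \<inter> space M \<in> sets M"
    using s by (auto simp: simple_function_def)
  ultimately show "(\<lambda>x. f x - s x) -` U \<inter> space M \<in> sets M"
    by (metis (no_types, lifting) sets.finite_UN sets.Int)
qed

lemma borel_measurable_norm_diff_simple_function:
  fixes f s :: "'w \<Rightarrow> 'a::real_normed_vector"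
  assumes "f \<in> borel_measurable M" and "simple_function M s"
  shows "(\<lambda>x. ennreal (norm (f x - s x))) \<in> borel_measurable M"
  using borel_measurable_diff_simple_function[OF assms] by measurable

text \<open>For the simple functions approximating \<open>f\<close> this is the triangle inequality
  with an extra approximation error, which vanishes in the limit.\<close>

lemma bochner_integral_of_norm_diff_le:
  assumes "bochner_integral_of M f v" and t: "Bochner_Integration.simple_bochner_integrable M t"
  shows "ennreal (norm (v - Bochner_Integration.simple_bochner_integral M t))
    \<le> (\<integral>\<^sup>+x. ennreal (norm (f x - t x)) \<partial>M)"
proof -
  let ?I = "Bochner_Integration.simple_bochner_integral M"
  from assms obtain s where f: "f \<in> borel_measurable M"
    and s: "\<And>i. Bochner_Integration.simple_bochner_integrable M (s i)"
    and lim: "(\<lambda>i. \<integral>\<^sup>+x. ennreal (norm (f x - s i x)) \<partial>M) \<longlonglongrightarrow> 0"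
    and I: "(\<lambda>i. ?I (s i)) \<longlonglongrightarrow> v"
    unfolding bochner_integral_of_def by blast
  have simp: "simple_function M (s i)" "simple_function M t" for i
    using s t by (auto elim: Bochner_Integration.simple_bochner_integrable.cases)
  let ?T = "\<integral>\<^sup>+x. ennreal (norm (f x - t x)) \<partial>M"
  have bound: "ennreal (norm (?I (s i) - ?I t)) \<le> (\<integral>\<^sup>+x. ennreal (norm (f x - s i x)) \<partial>M) + ?T" for i
  proof -
    have "ennreal (norm (?I (s i) - ?I t)) = ennreal (norm (?I (\<lambda>x. s i x - t x)))"
      using s t by (subst Bochner_Integration.simple_bochner_integral_diff) auto
    also have "\<dots> \<le> ?I (\<lambda>x. norm (s i x - t x))"
      using Bochner_Integration.simple_bochner_integrable_compose2[of "(-)" M "s i" "t"] s t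
      by (auto intro!: Bochner_Integration.simple_bochner_integral_norm_bound)
    also have "\<dots> = (\<integral>\<^sup>+x. norm (s i x - t x) \<partial>M)"
      using Bochner_Integration.simple_bochner_integrable_compose2[of "\<lambda>x y. norm (x - y)" M "s i" "t"] s t
      by (auto intro!: Bochner_Integration.simple_bochner_integral_eq_nn_integral)
    also have "\<dots> \<le> (\<integral>\<^sup>+x. ennreal (norm (f x - s i x)) + ennreal (norm (f x - t x)) \<partial>M)"
    proof (rule nn_integral_mono)
      fix x
      have "norm (s i x - t x) \<le> norm (f x - s i x) + norm (f x - t x)"
        by (metis dual_order.refl norm_diff_triangle_le norm_minus_commute)
      then show "ennreal (norm (s i x - t x)) \<le> ennreal (norm (f x - s i x)) + ennreal (norm (f x - t x))"
        by (simp flip: ennreal_plus)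
    qed
    also have "\<dots> = (\<integral>\<^sup>+x. ennreal (norm (f x - s i x)) \<partial>M) + ?T"
      by (intro nn_integral_add borel_measurable_norm_diff_simple_function f simp)
    finally show ?thesis .
  qed
  have "(\<lambda>i. ennreal (norm (?I (s i) - ?I t))) \<longlonglongrightarrow> ennreal (norm (v - ?I t))"
    by (intro tendsto_ennrealI tendsto_norm tendsto_diff I tendsto_const)
  moreover have "(\<lambda>i. (\<integral>\<^sup>+x. ennreal (norm (f x - s i x)) \<partial>M) + ?T) \<longlonglongrightarrow> 0 + ?T"
    by (intro tendsto_add lim tendsto_const)
  ultimately show ?thesis
    using bound by (intro LIMSEQ_le[where X = "\<lambda>i. ennreal (norm (?I (s i) - ?I t))"]) auto
qed

lemma simple_bochner_integral_indicator_scaleR: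
  assumes "finite_measure M" and A: "A \<in> sets M"
  shows "Bochner_Integration.simple_bochner_integrable M (\<lambda>x. indicator A x *\<^sub>R c)"
    and "Bochner_Integration.simple_bochner_integral M (\<lambda>x. indicator A x *\<^sub>R c) = measure M A *\<^sub>R c"
proof -
  interpret finite_measure M by fact
  have ind: "Bochner_Integration.simple_bochner_integrable M (indicator A :: _ \<Rightarrow> real)"
    using A by (intro Bochner_Integration.simple_bochner_integrable.intros) auto
  show "Bochner_Integration.simple_bochner_integrable M (\<lambda>x. indicator A x *\<^sub>R c)"
    using Bochner_Integration.simple_bochner_integrable_compose2[where p = "\<lambda>x y. x *\<^sub>R c", OF _ ind ind]
    by simp
  have "Bochner_Integration.simple_bochner_integral M (indicator A :: _ \<Rightarrow> real) = measure M A"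
  proof -
    have "ennreal (Bochner_Integration.simple_bochner_integral M (indicator A :: _ \<Rightarrow> real)) = ennreal (measure M A)"
      using A by (subst Bochner_Integration.simple_bochner_integral_eq_nn_integral[OF ind])
        (auto simp: ennreal_indicator emeasure_eq_measure)
    then show ?thesis by (subst (asm) ennreal_inj) auto
  qed
  moreover have "linear (\<lambda>r. r *\<^sub>R c)" by (simp add: linearI scaleR_add_left)
  ultimately show "Bochner_Integration.simple_bochner_integral M (\<lambda>x. indicator A x *\<^sub>R c) = measure M A *\<^sub>R c"
    using Bochner_Integration.simple_bochner_integral_linear[of "\<lambda>r. r *\<^sub>R c", OF _ ind] by simp
qed

text \<open>
  The \<open>n\<close>-th partition cuts \<open>[0,1)\<close> into \<open>M n\<close> intervals of equal length. Nothing forces the mesh to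
  tend to \<open>0\<close>, so the measure lives on the \<open>\<sigma>\<close>-algebra generated by the cells, not on all Borel sets.
\<close>

locale refining_partitions =
  fixes M N :: "nat \<Rightarrow> nat"
  assumes M_pos: "M n > 0" and M_Suc: "M (Suc n) = M n * N n"
begin

lemma N_pos: "N n > 0"
  using M_pos[of "Suc n"] by (auto simp: M_Suc intro: gr0I)

text \<open>For \<open>t\<close> in \<open>[0,1)\<close>, the index of the interval of the
  \<open>n\<close>-th partition that contains \<open>t\<close>; \<open>level n J\<close> is then the
  union of the intervals with index in \<open>J\<close>.\<close>

definition \<kappa> :: "nat \<Rightarrow> real \<Rightarrow> nat" where
  "\<kappa> n t = nat \<lfloor>real (M n) * t\<rfloor>"

definition level :: "nat \<Rightarrow> nat set \<Rightarrow> real set" where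
  "level n J = {t \<in> {0..<1}. \<kappa> n t \<in> J}"

abbreviation cell :: "nat \<Rightarrow> nat \<Rightarrow> real set" where
  "cell n j \<equiv> level n {j}"

definition ms :: "real measure" where
  "ms = measure_of {0..<1} {cell n j | n j. True} (emeasure lborel)"

lemma \<kappa>_less: "t \<in> {0..<1} \<Longrightarrow> \<kappa> n t < M n"
  using M_pos[of n] by (auto simp: \<kappa>_def nat_less_iff floor_less_iff)

text \<open>Taking the floor before an integer division does not change the result. Hence
  \<open>l div N n\<close> is the index of the parent of cell \<open>l\<close>.\<close>

lemma \<kappa>_Suc: "\<kappa> (Suc n) t div N n = \<kappa> n t"
proof -
  have "\<lfloor>real (M (Suc n)) * t\<rfloor> div int (N n) = \<lfloor>real (M n) * t\<rfloor>"
    using floor_divide_real_eq_div[of "int (N n)" "real (M (Suc n)) * t"] N_pos[of n]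
    by (simp add: M_Suc)
  then show ?thesis
    using nat_div_distrib'[of "int (N n)" "\<lfloor>real (M (Suc n)) * t\<rfloor>"] by (simp add: \<kappa>_def)
qed

lemma level_Suc: "level n J = level (Suc n) {l. l div N n \<in> J}"
  by (auto simp: level_def \<kappa>_Suc)

lemma level_mono: "n \<le> m \<Longrightarrow> \<exists>J'. level n J = level m J'"
proof (induction m rule: dec_induct)
  case (step m)
  then show ?case using level_Suc[of m] by metis
qed auto

lemma cell_eq:
  assumes "j < M n"
  shows "cell n j = {real j / real (M n) ..< real (Suc j) / real (M n)}"
proof -
  have *: "(0 \<le> t \<and> t < 1 \<and> \<kappa> n t = j) \<longleftrightarrow> (real j \<le> t * real (M n) \<and> t * real (M n) < real (Suc j))" for t
  proof
    assume a: "0 \<le> t \<and> t < 1 \<and> \<kappa> n t = j"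
    then have "\<lfloor>t * real (M n)\<rfloor> = int j" by (auto simp: \<kappa>_def mult.commute)
    then show "real j \<le> t * real (M n) \<and> t * real (M n) < real (Suc j)"
      by (simp add: floor_eq_iff add.commute)
  next
    assume a: "real j \<le> t * real (M n) \<and> t * real (M n) < real (Suc j)"
    then have "0 \<le> t * real (M n)" by (meson of_nat_0_le_iff order_trans)
    then have "0 \<le> t" using M_pos[of n] by (simp add: zero_le_mult_iff)
    moreover have "t * real (M n) < 1 * real (M n)"
      using a assms by (metis Suc_leI less_le_trans mult_1 of_nat_le_iff)
    then have "t < 1" using M_pos[of n] by (simp only: mult_less_cancel_right)
    moreover have "\<lfloor>t * real (M n)\<rfloor> = int j" using a by (intro floor_unique) auto
    ultimately show "0 \<le> t \<and> t < 1 \<and> \<kappa> n t = j" by (simp add: \<kappa>_def mult.commute)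
  qed
  show ?thesis
  proof (rule set_eqI)
    fix t
    have "t \<in> cell n j \<longleftrightarrow> (0 \<le> t \<and> t < 1 \<and> \<kappa> n t = j)" by (auto simp: level_def)
    also note *
    also have "(real j \<le> t * real (M n) \<and> t * real (M n) < real (Suc j))
        \<longleftrightarrow> t \<in> {real j / real (M n) ..< real (Suc j) / real (M n)}"
      using M_pos[of n] by (simp add: pos_divide_le_eq pos_less_divide_eq)
    finally show "t \<in> cell n j \<longleftrightarrow> t \<in> {real j / real (M n) ..< real (Suc j) / real (M n)}" .
  qed
qed

lemma cell_empty: "j \<ge> M n \<Longrightarrow> cell n j = {}"
  using \<kappa>_less[of _ n] by (auto simp: level_def not_less[symmetric])

lemma level_UN: "level n J = (\<Union>j\<in>J. cell n j)"
  by (auto simp: level_def)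

lemma cell_lborel: "cell n j \<in> sets lborel"
  by (cases "j < M n") (auto simp: cell_eq cell_empty)

lemma space_ms [simp]: "space ms = {0..<1}"
  unfolding ms_def by (rule space_measure_of) (auto simp: level_def)

lemma sets_ms: "sets ms = sigma_sets {0..<1} {cell n j | n j. True}"
  unfolding ms_def by (rule sets_measure_of) (auto simp: level_def)

lemma sets_ms_lborel: "A \<in> sets ms \<Longrightarrow> A \<in> sets lborel"
proof -
  have "sigma_sets {0..<1} {cell n j | n j. True} \<subseteq> sets lborel"
  proof
    fix A assume "A \<in> sigma_sets {0..<1} {cell n j | n j. True}"
    then show "A \<in> sets lborel" by induction (use cell_lborel in auto)
  qed
  then show "A \<in> sets ms \<Longrightarrow> A \<in> sets lborel" by (auto simp: sets_ms)
qed

lemma emeasure_ms: "A \<in> sets ms \<Longrightarrow> emeasure ms A = emeasure lborel A"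
proof (rule emeasure_measure_of[OF ms_def])
  show "countably_additive (sets ms) (emeasure lborel)"
    unfolding countably_additive_def using sets_ms_lborel by (auto intro!: suminf_emeasure)
qed (auto simp: level_def positive_def)

sublocale ms: finite_measure ms
  by (rule finite_measureI) (use emeasure_ms[OF sets.top] in simp)

abbreviation \<mu> :: "real set \<Rightarrow> real" where "\<mu> \<equiv> measure ms"

lemma level_sets [measurable, simp]: "level n J \<in> sets ms"
proof -
  have "cell n j \<in> sets ms" for j by (auto simp: sets_ms)
  then show ?thesis by (subst level_UN) (intro sets.countable_UN', auto)
qed

lemma measure_cell: "j < M n \<Longrightarrow> \<mu> (cell n j) = 1 / real (M n)"
proof -
  assume "j < M n"
  then have "emeasure ms (cell n j) = ennreal (1 / real (M n))"
    by (simp add: emeasure_ms del: level_def) (simp add: cell_eq divide_right_mono diff_divide_distrib[symmetric])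
  then show ?thesis by (simp add: measure_def)
qed

section \<open>Splitting and approximation of measurable sets along cells\<close>

lemma cell_inter: "cell n i \<inter> cell n j = (if i = j then cell n i else {})"
  by (auto simp: level_def)

lemma level_inter_cell: "level n J \<inter> cell n j = (if j \<in> J then cell n j else {})"
  by (auto simp: level_def)

lemma measure_split_cells:
  assumes A: "A \<in> sets ms"
  shows "(\<Sum>j<M n. \<mu> (A \<inter> cell n j)) = \<mu> A"
proof -
  have "A = (\<Union>j<M n. A \<inter> cell n j)"
    using sets.sets_into_space[OF A] \<kappa>_less by (auto simp: level_def)
  then have "\<mu> A = \<mu> (\<Union>j<M n. A \<inter> cell n j)" by simp
  also have "\<dots> = (\<Sum>j<M n. \<mu> (A \<inter> cell n j))"
    using A by (intro ms.finite_measure_finite_Union) (auto simp: disjoint_family_on_def, auto simp: level_def)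
  finally show ?thesis by simp
qed

text \<open>Induction over the generated \<sigma>-algebra. Asking for approximation at all late
  levels, not just at one, lets finitely many sets be approximated at a common level, which the
  union step needs.\<close>

lemma eventually_level_approx:
  assumes "A \<in> sets ms" "\<eta> > 0"
  shows "\<forall>\<^sub>F m in sequentially. \<exists>J. \<mu> (sym_diff A (level m J)) < \<eta>"
proof -
  have "A \<in> sigma_sets {0..<1} {cell n j | n j. True}" using assms by (simp add: sets_ms)
  then show ?thesis using \<open>\<eta> > 0\<close>
  proof (induction arbitrary: \<eta>)
    case (Basic A)
    then obtain n j where A: "A = cell n j" by auto
    show ?case
    proof (rule eventually_sequentiallyI[of n])
      fix m assume "n \<le> m"
      then obtain J where "cell n j = level m J" using level_mono by metis
      then show "\<exists>J. \<mu> (sym_diff A (level m J)) < \<eta>" using A Basic by (intro exI[of _ J]) simp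
    qed
  next
    case Empty
    then show ?case by (intro always_eventually allI exI[of _ "{}"]) (simp add: level_def)
  next
    case (Compl A)
    have sub: "A \<subseteq> {0..<1}" using Compl(1) sets.sets_into_space[of A ms] by (simp add: sets_ms)
    have "sym_diff ({0..<1} - A) (level m (- J)) = sym_diff A (level m J)" for m J
      using sub by (auto simp: level_def)
    then show ?case using Compl.IH[OF Compl.prems]
      by (elim eventually_mono) metis
  next
    case (Union A)
    have A: "A i \<in> sets ms" for i using Union(1) by (simp add: sets_ms)
    \<comment> \<open>By continuity from below, finitely many \<open>A i\<close> already exhaust the
      union up to \<open>\<eta> / 2\<close>.\<close>
    have "(\<lambda>k. \<mu> (\<Union>i<k. A i)) \<longlonglongrightarrow> \<mu> (\<Union>k. \<Union>i<k. A i)"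
    proof (rule ms.finite_Lim_measure_incseq)
      show "range (\<lambda>k. \<Union>i<k. A i) \<subseteq> sets ms" using A by auto
      show "incseq (\<lambda>k. \<Union>i<k. A i)" by (intro incseq_SucI UN_mono) auto
    qed
    moreover have "(\<Union>k. \<Union>i<k. A i) = (\<Union>i. A i)" by auto
    ultimately have "\<forall>\<^sub>F k in sequentially. \<mu> (\<Union>i<k. A i) > \<mu> (\<Union>i. A i) - \<eta> / 2"
      using Union.prems by (intro order_tendstoD(1)) auto
    then obtain k where k: "\<mu> (\<Union>i<k. A i) > \<mu> (\<Union>i. A i) - \<eta> / 2"
      by (auto simp: eventually_sequentially)
    have "\<mu> ((\<Union>i. A i) - (\<Union>i<k. A i)) = \<mu> (\<Union>i. A i) - \<mu> (\<Union>i<k. A i)"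
      using A by (intro ms.finite_measure_Diff) auto
    then have rest: "\<mu> ((\<Union>i. A i) - (\<Union>i<k. A i)) < \<eta> / 2" using k by simp
    \<comment> \<open>The other half of \<open>\<eta>\<close> is shared among \<open>k\<close> sets;
      the summand 1 covers \<open>k = 0\<close>.\<close>
    define \<theta> where "\<theta> = \<eta> / (2 * (real k + 1))"
    have "\<theta> > 0" using Union.prems by (simp add: \<theta>_def)
    then have "\<forall>\<^sub>F m in sequentially. \<forall>i\<in>{..<k}. \<exists>J. \<mu> (sym_diff (A i) (level m J)) < \<theta>"
      by (intro eventually_ball_finite) (auto intro: Union.IH)
    then show ?case
    proof eventually_elim
      case (elim m)
      then obtain J where J: "\<And>i. i < k \<Longrightarrow> \<mu> (sym_diff (A i) (level m (J i))) < \<theta>"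
        by (metis lessThan_iff)
      let ?R = "(\<Union>i. A i) - (\<Union>i<k. A i)"
      let ?U = "\<Union>i<k. sym_diff (A i) (level m (J i))"
      have "sym_diff (\<Union>i. A i) (level m (\<Union>i<k. J i)) \<subseteq> ?R \<union> ?U"
        by (auto simp: level_def)
      then have "\<mu> (sym_diff (\<Union>i. A i) (level m (\<Union>i<k. J i))) \<le> \<mu> (?R \<union> ?U)"
        using A by (intro ms.finite_measure_mono) auto
      also have "\<dots> \<le> \<mu> ?R + \<mu> ?U" using A by (intro measure_Un_le) auto
      also have "\<mu> ?U \<le> (\<Sum>i<k. \<mu> (sym_diff (A i) (level m (J i))))"
        using A by (intro ms.finite_measure_subadditive_finite) auto
      also have "\<dots> \<le> (\<Sum>i<k. \<theta>)" using J by (intro sum_mono) (auto intro: less_imp_le)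
      also have "\<dots> \<le> \<eta> / 2"
        using Union.prems by (simp add: \<theta>_def field_simps)
      finally show ?case using rest by (intro exI[of _ "\<Union>i<k. J i"]) simp
    qed
  qed
qed

text \<open>The finitely many fibres of \<open>s\<close> are approximated by unions of cells of one
  level. The error is at most the sum of the measures of the mismatches, weighted with the norms of
  the values.\<close>

lemma eventually_step_approx:
  fixes s :: "real \<Rightarrow> 'a::real_normed_vector"
  assumes s: "simple_function ms s" and "\<eta> > 0"
  shows "\<forall>\<^sub>F m in sequentially. \<exists>c. (\<integral>\<^sup>+x. ennreal (norm (s x - c (\<kappa> m x))) \<partial>ms) < ennreal \<eta>"
proof -
  define Y where "Y = s ` {0..<1}"
  have fin: "finite Y" using s by (simp add: Y_def simple_function_def)
  define A where "A y = s -` {y} \<inter> {0..<1}" for y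
  have A: "A y \<in> sets ms" for y
    using simple_functionD(2)[OF s, of "{y}"] by (simp add: A_def)
  \<comment> \<open>The mismatch for \<open>y\<close> costs \<open>norm y\<close> times its measure.
    The 1 in \<open>norm y + 1\<close> covers \<open>y = 0\<close>, and the 1 in
    \<open>card Y + 1\<close> makes the total strictly less than \<open>\<eta>\<close>.\<close>
  define \<theta> where "\<theta> y = \<eta> / ((norm y + 1) * (real (card Y) + 1))" for y :: 'a
  have \<theta>: "\<theta> y > 0" for y
    using \<open>\<eta> > 0\<close> by (auto simp: \<theta>_def intro!: divide_pos_pos mult_pos_pos add_nonneg_pos)
  have "\<forall>\<^sub>F m in sequentially. \<forall>y\<in>Y. \<exists>J. \<mu> (sym_diff (A y) (level m J)) < \<theta> y"
    using A \<theta> by (intro eventually_ball_finite fin ballI eventually_level_approx) auto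
  then show ?thesis
  proof eventually_elim
    case (elim m)
    then obtain J where J: "\<And>y. y \<in> Y \<Longrightarrow> \<mu> (sym_diff (A y) (level m (J y))) < \<theta> y"
      by metis
    \<comment> \<open>The sets \<open>J y\<close> may overlap or fail to cover; \<open>c\<close>
      adds all values whose set contains \<open>j\<close>, and the mismatches account for the
      defect.\<close>
    define c where "c j = (\<Sum>y\<in>Y. indicator (J y) j *\<^sub>R y)" for j
    let ?D = "\<lambda>y. sym_diff (A y) (level m (J y))"
    have D: "?D y \<in> sets ms" for y using A by auto
    have pt: "norm (s x - c (\<kappa> m x)) \<le> (\<Sum>y\<in>Y. norm y * indicator (?D y) x)" if x: "x \<in> {0..<1}" for x
    proof -
      have "s x = (\<Sum>y\<in>Y. indicator (A y) x *\<^sub>R y)"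
      proof -
        have "(\<Sum>y\<in>Y. indicator (A y) x *\<^sub>R y) = (\<Sum>y\<in>Y. if y = s x then y else 0)"
          using x by (intro sum.cong) (auto simp: A_def indicator_def)
        then show ?thesis using fin x by (simp add: Y_def)
      qed
      moreover have "c (\<kappa> m x) = (\<Sum>y\<in>Y. indicator (level m (J y)) x *\<^sub>R y)"
        using x by (auto simp: c_def level_def indicator_def intro!: sum.cong)
      ultimately have "s x - c (\<kappa> m x) = (\<Sum>y\<in>Y. (indicator (A y) x - indicator (level m (J y)) x) *\<^sub>R y)"
        by (simp add: sum_subtractf scaleR_diff_left)
      also have "norm \<dots> \<le> (\<Sum>y\<in>Y. norm ((indicator (A y) x - indicator (level m (J y)) x) *\<^sub>R y))"
        by (rule norm_sum)
      also have "\<dots> \<le> (\<Sum>y\<in>Y. norm y * indicator (?D y) x)"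
        by (intro sum_mono) (auto simp: indicator_def)
      finally show ?thesis .
    qed
    have "(\<integral>\<^sup>+x. ennreal (norm (s x - c (\<kappa> m x))) \<partial>ms) \<le> (\<integral>\<^sup>+x. (\<Sum>y\<in>Y. ennreal (norm y) * indicator (?D y) x) \<partial>ms)"
    proof (rule nn_integral_mono)
      fix x assume "x \<in> space ms"
      then have "ennreal (norm (s x - c (\<kappa> m x))) \<le> ennreal (\<Sum>y\<in>Y. norm y * indicator (?D y) x)"
        using pt by (intro ennreal_leI) auto
      also have "\<dots> = (\<Sum>y\<in>Y. ennreal (norm y * indicator (?D y) x))"
        by (rule sum_ennreal[symmetric]) (simp add: zero_le_mult_iff)
      also have "\<dots> = (\<Sum>y\<in>Y. ennreal (norm y) * indicator (?D y) x)"
        by (intro sum.cong) (auto simp: indicator_def)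
      finally show "ennreal (norm (s x - c (\<kappa> m x))) \<le> (\<Sum>y\<in>Y. ennreal (norm y) * indicator (?D y) x)" .
    qed
    also have "\<dots> = (\<Sum>y\<in>Y. \<integral>\<^sup>+x. ennreal (norm y) * indicator (?D y) x \<partial>ms)"
      using D by (intro nn_integral_sum) auto
    also have "\<dots> = (\<Sum>y\<in>Y. ennreal (norm y) * emeasure ms (?D y))"
      using D by (intro sum.cong nn_integral_cmult_indicator) auto
    also have "\<dots> = ennreal (\<Sum>y\<in>Y. norm y * \<mu> (?D y))"
      by (subst sum_ennreal[symmetric]) (auto simp: ms.emeasure_eq_measure ennreal_mult)
    also have "\<dots> < ennreal \<eta>"
    proof (rule ennreal_lessI)
      have "(\<Sum>y\<in>Y. norm y * \<mu> (?D y)) \<le> (\<Sum>y\<in>Y. \<eta> / (real (card Y) + 1))"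
      proof (rule sum_mono)
        fix y assume "y \<in> Y"
        have "norm y * \<mu> (?D y) \<le> (norm y + 1) * \<theta> y"
          using J[OF \<open>y \<in> Y\<close>] by (intro mult_mono) auto
        also have "\<dots> = \<eta> / (real (card Y) + 1)"
          by (simp add: \<theta>_def add_nonneg_eq_0_iff)
        finally show "norm y * \<mu> (?D y) \<le> \<eta> / (real (card Y) + 1)" .
      qed
      also have "\<dots> < \<eta>" using \<open>\<eta> > 0\<close> by (simp add: field_simps)
      finally show "(\<Sum>y\<in>Y. norm y * \<mu> (?D y)) < \<eta>" .
    qed (use \<open>\<eta> > 0\<close> in simp)
    finally show ?case by blast
  qed
qed

end

section \<open>Quasi-martingales and the Radon--Nikodym property\<close>

text \<open>
  \<open>v n\<close> is the step function with value \<open>v n j\<close> on the \<open>j\<close>-th cell; the children of cell \<open>j\<close> are the cells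
  \<open>j * N n + i\<close> with \<open>i < N n\<close>. Values \<open>v n j\<close> with \<open>j \<ge> M n\<close> are irrelevant.
\<close>

locale quasi_martingale = refining_partitions +
  fixes v :: "nat \<Rightarrow> nat \<Rightarrow> 'a::banach" and R :: real
  assumes v_bound: "norm (v n j) \<le> R"
    and summable_drift: "summable (\<lambda>n. (\<Sum>j<M n.
      norm ((1 / real (N n)) *\<^sub>R (\<Sum>i<N n. v (Suc n) (j * N n + i)) - v n j)) / real (M n))"
begin

definition e :: "nat \<Rightarrow> nat \<Rightarrow> real" where
  "e n j = norm ((1 / real (N n)) *\<^sub>R (\<Sum>i<N n. v (Suc n) (j * N n + i)) - v n j)"

text \<open>The integral over \<open>A\<close> of the \<open>n\<close>-th step function;
  \<open>drift\<close> integrates the local defects \<open>e\<close> of the martingale property in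
  the same way.\<close>

definition S :: "nat \<Rightarrow> real set \<Rightarrow> 'a" where
  "S n A = (\<Sum>j<M n. \<mu> (A \<inter> cell n j) *\<^sub>R v n j)"

definition drift :: "nat \<Rightarrow> real set \<Rightarrow> real" where
  "drift n A = (\<Sum>j<M n. \<mu> (A \<inter> cell n j) * e n j)"

definition G :: "real set \<Rightarrow> 'a" where
  "G A = lim (\<lambda>n. S n A)"

abbreviation total_drift :: "nat \<Rightarrow> real" where
  "total_drift n \<equiv> drift n {0..<1}"

section \<open>Drift estimates for the integrals of the step functions\<close>

lemma R_nonneg: "R \<ge> 0"
  using v_bound norm_ge_zero order_trans by blast

lemma e_nonneg: "e n j \<ge> 0"
  by (simp add: e_def)

lemma cell_Int_space: "{0..<1} \<inter> cell n j = cell n j"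
  by (auto simp: level_def)

lemma total_drift_eq: "total_drift n = (\<Sum>j<M n. e n j) / real (M n)"
  by (simp add: drift_def cell_Int_space measure_cell sum_divide_distrib)

lemma summable_total_drift: "summable total_drift"
  using summable_drift by (simp add: total_drift_eq e_def)

lemma drift_nonneg: "drift n A \<ge> 0"
  by (simp add: drift_def sum_nonneg e_nonneg)

lemma drift_le_total: "A \<in> sets ms \<Longrightarrow> drift n A \<le> total_drift n"
  unfolding drift_def cell_Int_space
  by (intro sum_mono mult_right_mono e_nonneg ms.finite_measure_mono) auto

lemma drift_cells: "(\<Sum>i<M n. drift k (cell n i)) = total_drift k"
proof -
  have "(\<Sum>i<M n. drift k (cell n i)) = (\<Sum>j<M k. (\<Sum>i<M n. \<mu> (cell k j \<inter> cell n i)) * e k j)"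
    unfolding drift_def by (subst sum.swap) (simp add: sum_distrib_right Int_commute)
  also have "\<dots> = total_drift k"
    by (simp add: measure_split_cells drift_def cell_Int_space)
  finally show ?thesis .
qed

text \<open>The measure of a set of level \<open>n\<close> splits evenly among the children of each
  of its cells. The next integral therefore sees only the mean over the children, whose distance
  from the parent value is \<open>e n j\<close>.\<close>

lemma S_Suc_diff_le: "norm (S (Suc n) (level n J) - S n (level n J)) \<le> drift n (level n J)"
proof -
  let ?A = "level n J"
  define a where "a j = \<mu> (?A \<inter> cell n j)" for j
  define w where "w j = (1 / real (N n)) *\<^sub>R (\<Sum>i<N n. v (Suc n) (j * N n + i))" for j
  have sub: "\<mu> (?A \<inter> cell (Suc n) (j * N n + i)) = a j / real (N n)" if j: "j < M n" and i: "i < N n" for i j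
  proof -
    have less: "j * N n + i < M (Suc n)"
    proof -
      have "j * N n + i < Suc j * N n" using i by simp
      also have "\<dots> \<le> M n * N n" using j by (intro mult_le_mono1) simp
      finally show ?thesis by (simp add: M_Suc)
    qed
    have "(j * N n + i) div N n = j" using i by simp
    then have "?A \<inter> cell (Suc n) (j * N n + i) = (if j \<in> J then cell (Suc n) (j * N n + i) else {})"
      by (subst level_Suc, subst level_inter_cell) simp
    moreover have "?A \<inter> cell n j = (if j \<in> J then cell n j else {})" by (rule level_inter_cell)
    ultimately show ?thesis
      unfolding a_def by (simp add: measure_cell[OF less] measure_cell[OF j] M_Suc)
  qed
  have "S (Suc n) ?A = (\<Sum>j<M n. \<Sum>i<N n. \<mu> (?A \<inter> cell (Suc n) (j * N n + i)) *\<^sub>R v (Suc n) (j * N n + i))"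
    unfolding S_def M_Suc sum.nat_group[symmetric]
  proof (rule sum.cong[OF refl])
    fix j assume "j \<in> {..<M n}"
    show "(\<Sum>l = j * N n..<j * N n + N n. \<mu> (?A \<inter> cell (Suc n) l) *\<^sub>R v (Suc n) l)
      = (\<Sum>i<N n. \<mu> (?A \<inter> cell (Suc n) (j * N n + i)) *\<^sub>R v (Suc n) (j * N n + i))"
      by (rule sum.reindex_bij_witness[of _ "\<lambda>i. j * N n + i" "\<lambda>l. l - j * N n"]) auto
  qed
  also have "\<dots> = (\<Sum>j<M n. a j *\<^sub>R w j)"
    by (intro sum.cong refl) (simp add: sub w_def scaleR_sum_right)
  finally have "S (Suc n) ?A - S n ?A = (\<Sum>j<M n. a j *\<^sub>R (w j - v n j))"
    by (simp add: S_def a_def sum_subtractf scaleR_diff_right)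
  also have "norm \<dots> \<le> (\<Sum>j<M n. norm (a j *\<^sub>R (w j - v n j)))" by (rule norm_sum)
  also have "\<dots> = drift n ?A" by (simp add: drift_def e_def w_def a_def)
  finally show ?thesis .
qed

text \<open>The constant does not depend on \<open>n\<close>: this carries convergence from unions
  of cells to all measurable sets, and with \<open>B = {}\<close> it controls the variation of the
  limit.\<close>

lemma S_diff_le:
  assumes A: "A \<in> sets ms" and B: "B \<in> sets ms"
  shows "norm (S n A - S n B) \<le> R * \<mu> (sym_diff A B)"
proof -
  have diff: "\<bar>\<mu> A' - \<mu> B'\<bar> \<le> \<mu> (sym_diff A' B')" if "A' \<in> sets ms" "B' \<in> sets ms" for A' B'
  proof -
    have "\<mu> A' \<le> \<mu> (B' \<union> sym_diff A' B')" "\<mu> B' \<le> \<mu> (A' \<union> sym_diff A' B')"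
      using that by (auto intro!: ms.finite_measure_mono)
    moreover have "\<mu> (B' \<union> sym_diff A' B') \<le> \<mu> B' + \<mu> (sym_diff A' B')"
      "\<mu> (A' \<union> sym_diff A' B') \<le> \<mu> A' + \<mu> (sym_diff A' B')"
      using that by (auto intro!: measure_Un_le)
    ultimately show ?thesis by linarith
  qed
  have eqn: "S n A - S n B = (\<Sum>j<M n. (\<mu> (A \<inter> cell n j) - \<mu> (B \<inter> cell n j)) *\<^sub>R v n j)"
    by (simp add: S_def sum_subtractf scaleR_diff_left)
  have "norm (S n A - S n B) \<le> (\<Sum>j<M n. norm ((\<mu> (A \<inter> cell n j) - \<mu> (B \<inter> cell n j)) *\<^sub>R v n j))"
    unfolding eqn by (rule norm_sum)
  also have "\<dots> \<le> (\<Sum>j<M n. \<mu> (sym_diff A B \<inter> cell n j) * R)"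
  proof (rule sum_mono)
    fix j
    have eq: "sym_diff (A \<inter> cell n j) (B \<inter> cell n j) = sym_diff A B \<inter> cell n j" by blast
    have *: "\<bar>\<mu> (A \<inter> cell n j) - \<mu> (B \<inter> cell n j)\<bar> \<le> \<mu> (sym_diff A B \<inter> cell n j)"
      unfolding eq[symmetric] by (rule diff) (intro sets.Int A B level_sets)+
    show "norm ((\<mu> (A \<inter> cell n j) - \<mu> (B \<inter> cell n j)) *\<^sub>R v n j) \<le> \<mu> (sym_diff A B \<inter> cell n j) * R"
      unfolding norm_scaleR by (rule mult_mono[OF * v_bound]) auto
  qed
  also have "\<dots> = R * \<mu> (sym_diff A B)"
  proof -
    have "sym_diff A B \<in> sets ms" using A B by blast
    then show ?thesis by (simp add: sum_distrib_right[symmetric] measure_split_cells)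
  qed
  finally show ?thesis .
qed

section \<open>The limit measure: existence, countable additivity, bounded variation\<close>

lemma S_empty: "S n {} = 0"
  by (simp add: S_def)

lemma S_Un:
  assumes "A \<in> sets ms" "B \<in> sets ms" "A \<inter> B = {}"
  shows "S n (A \<union> B) = S n A + S n B"
proof -
  have "\<mu> ((A \<union> B) \<inter> cell n j) = \<mu> (A \<inter> cell n j) + \<mu> (B \<inter> cell n j)" for j
    using assms by (subst Int_Un_distrib2, intro ms.finite_measure_Union) auto
  then show ?thesis by (simp add: S_def sum.distrib scaleR_add_left)
qed

text \<open>From level \<open>k\<close> on the set is a union of cells of the current level, so
  successive differences are dominated by the summable total drift.\<close>

lemma convergent_S_level: "convergent (\<lambda>n. S n (level k J))"
proof -
  have "summable (\<lambda>n. S (Suc (n + k)) (level k J) - S (n + k) (level k J))"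
  proof (rule summable_comparison_test')
    show "summable (\<lambda>n. total_drift (n + k))" using summable_total_drift by (rule summable_ignore_initial_segment)
    fix n
    obtain J' where J': "level k J = level (n + k) J'" using level_mono[of k "n + k"] by auto
    show "norm (S (Suc (n + k)) (level k J) - S (n + k) (level k J)) \<le> total_drift (n + k)"
      unfolding J' using S_Suc_diff_le[of "n + k" J'] drift_le_total[of "level (n + k) J'" "n + k"] by simp
  qed
  then have "convergent (\<lambda>n. \<Sum>i<n. S (Suc i + k) (level k J) - S (i + k) (level k J))"
    by (simp add: summable_iff_convergent)
  then have "convergent (\<lambda>n. S (n + k) (level k J) - S (0 + k) (level k J))"
    by (simp only: sum_lessThan_telescope[of "\<lambda>n. S (n + k) (level k J)"])
  then have "convergent (\<lambda>n. S (n + k) (level k J))"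
    using convergent_add[OF _ convergent_const[of "S k (level k J)"]] by fastforce
  then show ?thesis
    using convergent_ignore_initial_segment[of "\<lambda>n. S n (level k J)" k] by simp
qed

text \<open>Unions of cells are dense in measure and the integrals are equicontinuous in the set, so
  the Cauchy property carries over from such unions.\<close>

lemma S_tendsto_G: "A \<in> sets ms \<Longrightarrow> (\<lambda>n. S n A) \<longlonglongrightarrow> G A"
proof -
  assume A: "A \<in> sets ms"
  have "Cauchy (\<lambda>n. S n A)"
  proof (rule metric_CauchyI)
    fix \<eta> :: real assume "\<eta> > 0"
    \<comment> \<open>The factor \<open>R + 1\<close> covers \<open>R = 0\<close>, and
      \<open>\<eta> / 4\<close> leaves room for the strict thirds below.\<close>
    define \<theta> where "\<theta> = \<eta> / (4 * (R + 1))"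
    have "\<theta> > 0" using \<open>\<eta> > 0\<close> R_nonneg by (simp add: \<theta>_def)
    then obtain k J where B: "\<mu> (sym_diff A (level k J)) < \<theta>"
      using eventually_level_approx[OF A] eventually_happens' sequentially_bot by blast
    have close: "norm (S n A - S n (level k J)) < \<eta> / 3" for n
    proof -
      have "norm (S n A - S n (level k J)) \<le> R * \<mu> (sym_diff A (level k J))"
        using A by (intro S_diff_le) auto
      also have "\<dots> \<le> (R + 1) * \<theta>" using B R_nonneg by (intro mult_mono) auto
      also have "\<dots> = \<eta> / 4"
      proof -
        have "4 * R + 4 \<noteq> 0" using R_nonneg by linarith
        then show ?thesis by (simp add: \<theta>_def field_simps)
      qed
      finally show ?thesis using \<open>\<eta> > 0\<close> by simp
    qed
    obtain K where K: "\<And>m n. m \<ge> K \<Longrightarrow> n \<ge> K \<Longrightarrow> dist (S m (level k J)) (S n (level k J)) < \<eta> / 3"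
      using metric_CauchyD[OF convergent_Cauchy[OF convergent_S_level[of k J]], of "\<eta> / 3"] \<open>\<eta> > 0\<close>
      by auto
    have "dist (S m A) (S n A) < \<eta>" if "m \<ge> K" "n \<ge> K" for m n
      using close[of m] close[of n] K[OF that] unfolding dist_norm[symmetric]
      by (metis (no_types, opaque_lifting) dist_commute dist_triangle_third)
    then show "\<exists>K. \<forall>m\<ge>K. \<forall>n\<ge>K. dist (S m A) (S n A) < \<eta>" by blast
  qed
  then show ?thesis unfolding G_def by (simp add: Cauchy_convergent_iff convergent_LIMSEQ_iff)
qed

lemma norm_G_le:
  assumes A: "A \<in> sets ms"
  shows "norm (G A) \<le> R * \<mu> A"
proof (rule LIMSEQ_le_const2)
  show "(\<lambda>n. norm (S n A)) \<longlonglongrightarrow> norm (G A)" by (intro tendsto_norm S_tendsto_G A)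
  show "\<exists>N. \<forall>n\<ge>N. norm (S n A) \<le> R * \<mu> A" using S_diff_le[OF A, of "{}"] by (simp add: S_empty)
qed

lemma G_Un:
  assumes "A \<in> sets ms" "B \<in> sets ms" "A \<inter> B = {}"
  shows "G (A \<union> B) = G A + G B"
proof (rule LIMSEQ_unique)
  show "(\<lambda>n. S n (A \<union> B)) \<longlonglongrightarrow> G (A \<union> B)" using assms by (intro S_tendsto_G) auto
  show "(\<lambda>n. S n (A \<union> B)) \<longlonglongrightarrow> G A + G B"
    unfolding S_Un[OF assms] using assms by (intro tendsto_add S_tendsto_G)
qed

text \<open>Finite additivity survives the limit, and the tail of a countable union is bounded by
  \<open>R\<close> times its measure, which tends to zero.\<close>

lemma vector_measure_G: "vector_measure ms G"
  unfolding vector_measure_def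
proof (intro allI impI)
  fix A :: "nat \<Rightarrow> real set" assume "range A \<subseteq> sets ms" and disj: "disjoint_family A"
  then have A: "A i \<in> sets ms" for i by auto
  have G0: "G {} = 0" using norm_G_le[of "{}"] by simp
  have fin: "(\<Sum>i<k. G (A i)) = G (\<Union>i<k. A i)" for k
  proof (induction k)
    case (Suc k)
    have "A i \<inter> A k = {}" if "i < k" for i
      using disj that by (auto simp: disjoint_family_on_def)
    then have "(\<Union>i<k. A i) \<inter> A k = {}" by blast
    then have "G ((\<Union>i<k. A i) \<union> A k) = G (\<Union>i<k. A i) + G (A k)"
      using A by (intro G_Un) auto
    with Suc show ?case by (simp add: lessThan_Suc Un_commute)
  qed (simp add: G0)
  have rest: "norm (G (\<Union>i. A i) - (\<Sum>i<k. G (A i))) \<le> R * (\<mu> (\<Union>i. A i) - \<mu> (\<Union>i<k. A i))" for k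
  proof -
    let ?D = "(\<Union>i. A i) - (\<Union>i<k. A i)"
    have "(\<Union>i<k. A i) \<union> ?D = (\<Union>i. A i)" by auto
    then have "G (\<Union>i. A i) = G (\<Union>i<k. A i) + G ?D"
      using A G_Un[of "\<Union>i<k. A i" ?D] by auto
    moreover have "\<mu> ?D = \<mu> (\<Union>i. A i) - \<mu> (\<Union>i<k. A i)"
      using A by (intro ms.finite_measure_Diff) auto
    moreover have "norm (G ?D) \<le> R * \<mu> ?D" using A by (intro norm_G_le) auto
    ultimately show ?thesis by (simp add: fin)
  qed
  have "(\<lambda>k. \<mu> (\<Union>i<k. A i)) \<longlonglongrightarrow> \<mu> (\<Union>k. \<Union>i<k. A i)"
  proof (rule ms.finite_Lim_measure_incseq)
    show "range (\<lambda>k. \<Union>i<k. A i) \<subseteq> sets ms" using A by auto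
    show "incseq (\<lambda>k. \<Union>i<k. A i)" by (intro incseq_SucI UN_mono) auto
  qed
  moreover have "(\<Union>k. \<Union>i<k. A i) = (\<Union>i. A i)" by auto
  ultimately have "(\<lambda>k. R * (\<mu> (\<Union>i. A i) - \<mu> (\<Union>i<k. A i))) \<longlonglongrightarrow> R * (\<mu> (\<Union>i. A i) - \<mu> (\<Union>i. A i))"
    by (intro tendsto_intros) simp
  then have "(\<lambda>k. R * (\<mu> (\<Union>i. A i) - \<mu> (\<Union>i<k. A i))) \<longlonglongrightarrow> 0" by simp
  then have "(\<lambda>k. (\<Sum>i<k. G (A i)) - G (\<Union>i. A i)) \<longlonglongrightarrow> 0"
    by (rule Lim_null_comparison[rotated]) (use rest in \<open>auto simp: norm_minus_commute\<close>)
  then show "(\<lambda>n. G (A n)) sums G (\<Union>n. A n)"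
    unfolding sums_def by (rule LIM_zero_cancel)
qed

lemma bounded_variation_G: "bounded_variation_measure ms G"
  unfolding bounded_variation_measure_def
proof (intro exI allI impI)
  fix P assume fin: "finite P" and P: "P \<subseteq> sets ms" and part: "partition_on (space ms) P"
  have "(\<Sum>A\<in>P. norm (G A)) \<le> (\<Sum>A\<in>P. R * \<mu> A)"
    using P by (intro sum_mono norm_G_le) auto
  also have "\<dots> = R * (\<Sum>A\<in>P. \<mu> A)" by (simp add: sum_distrib_left)
  also have "(\<Sum>A\<in>P. \<mu> A) = \<mu> (\<Union>A\<in>P. A)"
    using P part fin by (intro ms.finite_measure_finite_Union[symmetric])
      (auto simp: disjoint_family_on_def partition_on_def disjoint_def)
  also have "(\<Union>A\<in>P. A) = space ms" using part by (simp add: partition_on_def)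
  finally show "(\<Sum>A\<in>P. norm (G A)) \<le> R * \<mu> (space ms)"
    using R_nonneg by (simp add: mult_left_mono)
qed

lemma G_null: "A \<in> null_sets ms \<Longrightarrow> G A = 0"
  using norm_G_le[of A] by (auto simp: null_sets_def measure_def)

text \<open>The left side is the \<open>L^1\<close> distance from the \<open>n\<close>-th step
  function to the averages of \<open>G\<close> over its cells. Each later step moves the integral
  over a cell of level \<open>n\<close> by at most the drift there, and over all cells these drifts
  add up to the total drift.\<close>

lemma S_G_cells_le: "(\<Sum>j<M n. norm (S n (cell n j) - G (cell n j))) \<le> (\<Sum>k. total_drift (k + n))"
proof -
  have step: "(\<Sum>j<M n. norm (S n (cell n j) - S (n + K) (cell n j))) \<le> (\<Sum>k<K. total_drift (k + n))" for K
  proof (induction K)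
    case (Suc K)
    have "norm (S n (cell n j) - S (n + Suc K) (cell n j))
      \<le> norm (S n (cell n j) - S (n + K) (cell n j)) + drift (n + K) (cell n j)" for j
    proof -
      obtain J' where J': "cell n j = level (n + K) J'" using level_mono[of n "n + K"] by auto
      have "norm (S (n + K) (cell n j) - S (n + Suc K) (cell n j)) \<le> drift (n + K) (cell n j)"
        unfolding J' using S_Suc_diff_le[of "n + K" J'] by (simp add: norm_minus_commute)
      then show ?thesis
        using norm_triangle_ineq[of "S n (cell n j) - S (n + K) (cell n j)" "S (n + K) (cell n j) - S (n + Suc K) (cell n j)"]
        by simp
    qed
    then have "(\<Sum>j<M n. norm (S n (cell n j) - S (n + Suc K) (cell n j)))
      \<le> (\<Sum>j<M n. norm (S n (cell n j) - S (n + K) (cell n j)) + drift (n + K) (cell n j))"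
      by (intro sum_mono)
    also have "\<dots> = (\<Sum>j<M n. norm (S n (cell n j) - S (n + K) (cell n j))) + total_drift (n + K)"
      by (simp add: sum.distrib drift_cells)
    finally show ?case using Suc by (simp add: add.commute)
  qed simp
  show ?thesis
  proof (rule LIMSEQ_le_const2)
    have "(\<lambda>K. S (n + K) (cell n j)) \<longlonglongrightarrow> G (cell n j)" for j
      using LIMSEQ_ignore_initial_segment[OF S_tendsto_G[of "cell n j"], of n] by (simp add: add.commute)
    then show "(\<lambda>K. \<Sum>j<M n. norm (S n (cell n j) - S (n + K) (cell n j)))
      \<longlonglongrightarrow> (\<Sum>j<M n. norm (S n (cell n j) - G (cell n j)))"
      by (intro tendsto_sum tendsto_norm tendsto_diff tendsto_const)
    have "(\<Sum>k<K. total_drift (k + n)) \<le> (\<Sum>k. total_drift (k + n))" for K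
      using summable_ignore_initial_segment[OF summable_total_drift, of n] drift_nonneg
      by (intro sum_le_suminf) auto
    then show "\<exists>K0. \<forall>K\<ge>K0. (\<Sum>j<M n. norm (S n (cell n j) - S (n + K) (cell n j))) \<le> (\<Sum>k. total_drift (k + n))"
      using step order_trans by blast
  qed
qed

lemma S_cell: "j < M n \<Longrightarrow> S n (cell n j) = (1 / real (M n)) *\<^sub>R v n j"
proof -
  assume j: "j < M n"
  have "S n (cell n j) = (\<Sum>i<M n. if i = j then (1 / real (M n)) *\<^sub>R v n j else 0)"
    unfolding S_def using j by (intro sum.cong) (auto simp: cell_inter measure_cell)
  then show ?thesis using j by simp
qed

section \<open>The density of the limit measure and small increments\<close>

lemma simple_function_step: "simple_function ms (\<lambda>x. c (\<kappa> n x))"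
proof -
  have "\<kappa> n ` space ms \<subseteq> {..<M n}" by (auto simp: \<kappa>_less)
  then have "finite (\<kappa> n ` space ms)" by (rule finite_subset) simp
  moreover have "\<kappa> n -` {j} \<inter> space ms = cell n j" for j by (auto simp: level_def)
  then have "\<kappa> n -` {j} \<inter> space ms \<in> sets ms" for j by (metis level_sets)
  ultimately have "simple_function ms (\<kappa> n)" unfolding simple_function_def by blast
  then show ?thesis by (rule simple_function_compose1)
qed

context
  fixes g :: "real \<Rightarrow> 'a"
  assumes g: "\<And>A. A \<in> sets ms \<Longrightarrow> bochner_integral_of ms (\<lambda>x. indicator A x *\<^sub>R g x) (G A)"
begin

lemma measurable_norm_diff_simple:
  assumes "simple_function ms s"
  shows "(\<lambda>x. ennreal (norm (g x - s x))) \<in> borel_measurable ms"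
proof -
  have "(\<lambda>x. indicator {0..<1} x *\<^sub>R g x) \<in> borel_measurable ms"
    using g[OF sets.top] unfolding bochner_integral_of_def space_ms by (rule conjunct1)
  note meas = borel_measurable_norm_diff_simple_function[OF this assms]
  have "(\<lambda>x. ennreal (norm (g x - s x))) \<in> borel_measurable ms \<longleftrightarrow>
    (\<lambda>x. ennreal (norm (indicator {0..<1} x *\<^sub>R g x - s x))) \<in> borel_measurable ms"
    by (rule measurable_cong) simp
  with meas show ?thesis by simp
qed

text \<open>Some simple function is within \<open>\<eta> / 2\<close> of \<open>g\<close> by the
  definition of the integral, and at every late level some step function is within
  \<open>\<eta> / 2\<close> of that simple function.\<close>

lemma eventually_density_approx:
  assumes "\<eta> > 0"
  shows "\<forall>\<^sub>F m in sequentially. \<exists>c. (\<integral>\<^sup>+x. ennreal (norm (g x - c (\<kappa> m x))) \<partial>ms) < ennreal \<eta>"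
proof -
  obtain s where s: "\<And>i. Bochner_Integration.simple_bochner_integrable ms (s i)"
    and lim: "(\<lambda>i. \<integral>\<^sup>+x. ennreal (norm (indicator {0..<1} x *\<^sub>R g x - s i x)) \<partial>ms) \<longlonglongrightarrow> 0"
    using g[OF sets.top] unfolding bochner_integral_of_def space_ms by blast
  have "\<forall>\<^sub>F i in sequentially. (\<integral>\<^sup>+x. ennreal (norm (indicator {0..<1} x *\<^sub>R g x - s i x)) \<partial>ms) < ennreal (\<eta> / 2)"
    using assms by (intro order_tendstoD(2)[OF lim]) simp
  then obtain i where "(\<integral>\<^sup>+x. ennreal (norm (indicator {0..<1} x *\<^sub>R g x - s i x)) \<partial>ms) < ennreal (\<eta> / 2)"
    using eventually_happens' sequentially_bot by blast
  also have "(\<integral>\<^sup>+x. ennreal (norm (indicator {0..<1} x *\<^sub>R g x - s i x)) \<partial>ms)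
      = (\<integral>\<^sup>+x. ennreal (norm (g x - s i x)) \<partial>ms)"
    by (intro nn_integral_cong) simp
  finally have i: "(\<integral>\<^sup>+x. ennreal (norm (g x - s i x)) \<partial>ms) < ennreal (\<eta> / 2)" .
  have simp: "simple_function ms (s i)" using s by (auto elim: Bochner_Integration.simple_bochner_integrable.cases)
  have "\<forall>\<^sub>F m in sequentially. \<exists>c. (\<integral>\<^sup>+x. ennreal (norm (s i x - c (\<kappa> m x))) \<partial>ms) < ennreal (\<eta> / 2)"
    using assms by (intro eventually_step_approx simp) simp
  then show ?thesis
  proof eventually_elim
    case (elim m)
    then obtain c where c: "(\<integral>\<^sup>+x. ennreal (norm (s i x - c (\<kappa> m x))) \<partial>ms) < ennreal (\<eta> / 2)" by blast
    have "(\<integral>\<^sup>+x. ennreal (norm (g x - c (\<kappa> m x))) \<partial>ms)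
      \<le> (\<integral>\<^sup>+x. ennreal (norm (g x - s i x)) + ennreal (norm (s i x - c (\<kappa> m x))) \<partial>ms)"
    proof (rule nn_integral_mono)
      fix x
      have "norm (g x - c (\<kappa> m x)) \<le> norm (g x - s i x) + norm (s i x - c (\<kappa> m x))"
        using norm_triangle_ineq[of "g x - s i x" "s i x - c (\<kappa> m x)"] by simp
      then show "ennreal (norm (g x - c (\<kappa> m x))) \<le> ennreal (norm (g x - s i x)) + ennreal (norm (s i x - c (\<kappa> m x)))"
        by (simp flip: ennreal_plus)
    qed
    also have "\<dots> = (\<integral>\<^sup>+x. ennreal (norm (g x - s i x)) \<partial>ms) + (\<integral>\<^sup>+x. ennreal (norm (s i x - c (\<kappa> m x))) \<partial>ms)"
      using simp by (intro nn_integral_add measurable_norm_diff_simple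
        borel_measurable_norm_diff_simple_function[OF borel_measurable_simple_function] simple_function_step)
    also have "\<dots> < ennreal (\<eta> / 2) + ennreal (\<eta> / 2)" using i c by (rule add_strict_mono)
    also have "\<dots> = ennreal \<eta>" using assms by (simp flip: ennreal_plus)
    finally show ?case by blast
  qed
qed

text \<open>The averages of \<open>G\<close> over cells serve as intermediary: the tail of the drift
  bounds their distance from \<open>v n\<close>, and averaging over cells does not increase the
  \<open>L^1\<close> distance from \<open>g\<close> to the step function \<open>c\<close>.\<close>

lemma v_diff_step_le:
  assumes c: "(\<integral>\<^sup>+x. ennreal (norm (g x - c (\<kappa> n x))) \<partial>ms) \<le> ennreal \<eta>" and "\<eta> \<ge> 0"
  shows "(\<Sum>j<M n. norm (v n j - c j)) / real (M n) \<le> (\<Sum>k. total_drift (k + n)) + \<eta>"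
proof -
  let ?h = "\<lambda>x. ennreal (norm (g x - c (\<kappa> n x)))"
  define d where "d j = norm (G (cell n j) - (1 / real (M n)) *\<^sub>R c j)" for j
  have d: "ennreal (d j) \<le> (\<integral>\<^sup>+x. ?h x * indicator (cell n j) x \<partial>ms)" if j: "j < M n" for j
  proof -
    note sb = simple_bochner_integral_indicator_scaleR[OF ms.finite_measure_axioms, of "cell n j" "c j"]
    have "ennreal (d j) \<le> (\<integral>\<^sup>+x. ennreal (norm (indicator (cell n j) x *\<^sub>R g x - indicator (cell n j) x *\<^sub>R c j)) \<partial>ms)"
      using bochner_integral_of_norm_diff_le[OF g sb(1)] sb(2) by (simp add: d_def measure_cell[OF j])
    also have "\<dots> = (\<integral>\<^sup>+x. ?h x * indicator (cell n j) x \<partial>ms)"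
      by (intro nn_integral_cong) (auto simp: indicator_def level_def)
    finally show ?thesis .
  qed
  have "ennreal (\<Sum>j<M n. d j) = (\<Sum>j<M n. ennreal (d j))"
    by (rule sum_ennreal[symmetric]) (simp add: d_def)
  also have "\<dots> \<le> (\<Sum>j<M n. \<integral>\<^sup>+x. ?h x * indicator (cell n j) x \<partial>ms)"
    using d by (intro sum_mono) auto
  also have "\<dots> = (\<integral>\<^sup>+x. (\<Sum>j<M n. ?h x * indicator (cell n j) x) \<partial>ms)"
    using measurable_norm_diff_simple[OF simple_function_step]
    by (intro nn_integral_sum[symmetric]) auto
  also have "\<dots> \<le> (\<integral>\<^sup>+x. ?h x \<partial>ms)"
  proof (rule nn_integral_mono)
    fix x
    have "(\<Sum>j<M n. indicator (cell n j) x :: ennreal) \<le> (\<Sum>j<M n. if j = \<kappa> n x then 1 else 0)"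
      by (intro sum_mono) (auto simp: indicator_def level_def)
    also have "\<dots> \<le> 1" by simp
    finally show "(\<Sum>j<M n. ?h x * indicator (cell n j) x) \<le> ?h x"
      by (subst sum_distrib_left[symmetric]) (metis mult.right_neutral mult_left_mono zero_le)
  qed
  also note c
  finally have sd: "(\<Sum>j<M n. d j) \<le> \<eta>" using \<open>\<eta> \<ge> 0\<close> by (simp add: ennreal_le_iff)
  have "(\<Sum>j<M n. norm (v n j - c j)) / real (M n) = (\<Sum>j<M n. norm ((1 / real (M n)) *\<^sub>R (v n j - c j)))"
    by (simp add: sum_divide_distrib)
  also have "\<dots> \<le> (\<Sum>j<M n. norm (S n (cell n j) - G (cell n j)) + d j)"
  proof (rule sum_mono)
    fix j assume "j \<in> {..<M n}"
    then have "(1 / real (M n)) *\<^sub>R (v n j - c j)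
      = (S n (cell n j) - G (cell n j)) + (G (cell n j) - (1 / real (M n)) *\<^sub>R c j)"
      by (simp add: S_cell scaleR_diff_right)
    then show "norm ((1 / real (M n)) *\<^sub>R (v n j - c j)) \<le> norm (S n (cell n j) - G (cell n j)) + d j"
      unfolding d_def by (metis norm_triangle_ineq)
  qed
  also have "\<dots> \<le> (\<Sum>k. total_drift (k + n)) + \<eta>"
    using S_G_cells_le[of n] sd by (simp add: sum.distrib)
  finally show ?thesis .
qed

end

lemma RNP_imp_small_increment:
  assumes "radon_nikodym_property TYPE('a)" and "\<epsilon> > 0"
  shows "\<exists>n l. norm (v (Suc n) l - v n (l div N n)) < \<epsilon>"
proof (rule ccontr)
  assume "\<not> ?thesis"
  then have far: "\<epsilon> \<le> norm (v (Suc n) l - v n (l div N n))" for n l by (auto simp: not_less)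
  have "RNP_wrt ms TYPE('a)"
    using assms(1) ms.finite_measure_axioms by (simp add: radon_nikodym_property_def)
  then obtain g where g: "\<And>A. A \<in> sets ms \<Longrightarrow> bochner_integral_of ms (\<lambda>x. indicator A x *\<^sub>R g x) (G A)"
    using vector_measure_G bounded_variation_G G_null unfolding RNP_wrt_def by blast
  \<comment> \<open>Two adjacent levels will each be within \<open>2 * \<eta>\<close> of one step
    function, so the mean increment is at most \<open>4 * \<eta>\<close>, half of
    \<open>\<epsilon>\<close>.\<close>
  define \<eta> where "\<eta> = \<epsilon> / 8"
  have "\<eta> > 0" using assms(2) by (simp add: \<eta>_def)
  have "(\<lambda>n. \<Sum>k. total_drift (k + n)) \<longlonglongrightarrow> 0"
    by (rule suminf_exist_split2[OF summable_total_drift])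
  then have tail: "\<forall>\<^sub>F n in sequentially. (\<Sum>k. total_drift (k + n)) < \<eta>"
    using \<open>\<eta> > 0\<close> by (rule order_tendstoD(2))
  from tail have tail': "\<forall>\<^sub>F n in sequentially. (\<Sum>k. total_drift (k + Suc n)) < \<eta>"
    by (subst (asm) eventually_sequentially_Suc[symmetric])
  obtain m c where c: "(\<integral>\<^sup>+x. ennreal (norm (g x - c (\<kappa> m x))) \<partial>ms) < ennreal \<eta>"
    and t: "(\<Sum>k. total_drift (k + m)) < \<eta>" "(\<Sum>k. total_drift (k + Suc m)) < \<eta>"
    using eventually_happens'[OF sequentially_bot
      eventually_conj[OF eventually_density_approx[OF g \<open>\<eta> > 0\<close>] eventually_conj[OF tail tail']]]
    by blast
  \<comment> \<open>The same step function written on level \<open>Suc m\<close>, children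
    inheriting the value of their parent; one approximation thus serves both levels.\<close>
  define c' where "c' l = c (l div N m)" for l
  let ?a = "(\<Sum>j<M m. norm (v m j - c j)) / real (M m)"
  let ?b = "(\<Sum>l<M (Suc m). norm (v (Suc m) l - c' l)) / real (M (Suc m))"
  have a: "?a \<le> 2 * \<eta>"
    using v_diff_step_le[OF g less_imp_le[OF c]] t \<open>\<eta> > 0\<close> by simp
  have c': "(\<integral>\<^sup>+x. ennreal (norm (g x - c' (\<kappa> (Suc m) x))) \<partial>ms) \<le> ennreal \<eta>"
    using c by (simp add: c'_def \<kappa>_Suc)
  have b: "?b \<le> 2 * \<eta>"
    using v_diff_step_le[OF g c'] t \<open>\<eta> > 0\<close> by simp
  \<comment> \<open>Each parent is counted once per child, which cancels against the larger number
    of cells.\<close>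
  have "(\<Sum>l<M (Suc m). norm (v m (l div N m) - c' l)) = (\<Sum>j<M m. \<Sum>l=j * N m..<j * N m + N m. norm (v m (l div N m) - c' l))"
    unfolding M_Suc by (rule sum.nat_group[symmetric])
  also have "\<dots> = (\<Sum>j<M m. \<Sum>l=j * N m..<j * N m + N m. norm (v m j - c j))"
  proof (intro sum.cong refl)
    fix j l assume "l \<in> {j * N m..<j * N m + N m}"
    then have "l div N m = j" by (intro div_nat_eqI) (auto simp: mult.commute)
    then show "norm (v m (l div N m) - c' l) = norm (v m j - c j)" by (simp add: c'_def)
  qed
  also have "\<dots> = real (N m) * (\<Sum>j<M m. norm (v m j - c j))" by (simp add: sum_distrib_left)
  finally have a': "(\<Sum>l<M (Suc m). norm (v m (l div N m) - c' l)) / real (M (Suc m)) = ?a"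
    using N_pos[of m] by (simp add: M_Suc)
  have "real (M (Suc m)) * \<epsilon> = (\<Sum>l<M (Suc m). \<epsilon>)" by simp
  also have "\<dots> \<le> (\<Sum>l<M (Suc m). norm (v (Suc m) l - c' l) + norm (v m (l div N m) - c' l))"
  proof (rule sum_mono)
    fix l
    show "\<epsilon> \<le> norm (v (Suc m) l - c' l) + norm (v m (l div N m) - c' l)"
      using far[of m l] norm_triangle_ineq4[of "v (Suc m) l - c' l" "v m (l div N m) - c' l"] by simp
  qed
  finally have "\<epsilon> \<le> (\<Sum>l<M (Suc m). norm (v (Suc m) l - c' l) + norm (v m (l div N m) - c' l)) / real (M (Suc m))"
    using M_pos[of "Suc m"] by (simp add: pos_le_divide_eq mult.commute)
  also have "\<dots> = ?b + ?a" by (simp add: sum.distrib add_divide_distrib a')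
  finally have "\<epsilon> \<le> 4 * \<eta>" using a b by simp
  then show False using assms(2) by (simp add: \<eta>_def)
qed

end

section \<open>Stegall's variational principle\<close>

lemma sum_mod_repeat:
  fixes h :: "nat \<Rightarrow> 'a::real_vector"
  shows "(\<Sum>i<q * n. h (i mod n)) = real q *\<^sub>R (\<Sum>i<n. h i)"
proof -
  have "(\<Sum>i=k * n..<k * n + n. h (i mod n)) = (\<Sum>i<n. h i)" for k
    by (rule sum.reindex_bij_witness[of _ "\<lambda>i. k * n + i" "\<lambda>i. i - k * n"])
      (auto simp: le_iff_add)
  then show ?thesis by (simp add: sum.nat_group[symmetric] sum_constant_scaleR)
qed

text \<open>One refinement of the quasi-martingale. The common number of children is the product of
  the lengths of the spreading lists for \<open>j < m\<close>, so that each of these lists fits in a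
  whole number of times.\<close>

lemma refine_step:
  fixes \<phi> :: "'a::real_normed_vector \<Rightarrow> real" and w :: "nat \<Rightarrow> 'a"
  assumes spread: "\<And>f. f \<in> C \<Longrightarrow> \<exists>gs. set gs \<subseteq> {g \<in> C. \<epsilon> \<le> norm (g - f)} \<and> gs \<noteq> [] \<and>
      \<delta> * norm (\<Sum>g\<leftarrow>gs. g - f) < (\<Sum>g\<leftarrow>gs. \<phi> g - \<phi> f + \<eta>)"
    and w: "\<And>j. w j \<in> C"
  shows "\<exists>N>0. \<exists>w'. (\<forall>l. w' l \<in> C) \<and> (\<forall>l. \<epsilon> \<le> norm (w' l - w (l div N))) \<and>
    (\<forall>j<m. \<delta> * norm (\<Sum>i<N. w' (j * N + i) - w j) \<le> (\<Sum>i<N. \<phi> (w' (j * N + i)) - \<phi> (w j) + \<eta>))"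
proof -
  obtain gs where gs: "\<And>j. set (gs j) \<subseteq> {g \<in> C. \<epsilon> \<le> norm (g - w j)}" "\<And>j. gs j \<noteq> []"
    "\<And>j. \<delta> * norm (\<Sum>g\<leftarrow>gs j. g - w j) < (\<Sum>g\<leftarrow>gs j. \<phi> g - \<phi> (w j) + \<eta>)"
  proof -
    have "\<forall>j. \<exists>gs. set gs \<subseteq> {g \<in> C. \<epsilon> \<le> norm (g - w j)} \<and> gs \<noteq> [] \<and>
      \<delta> * norm (\<Sum>g\<leftarrow>gs. g - w j) < (\<Sum>g\<leftarrow>gs. \<phi> g - \<phi> (w j) + \<eta>)"
      using spread[OF w] by (rule allI)
    from choice[OF this] that show ?thesis by blast
  qed
  define N where "N = (\<Prod>j<m. length (gs j))"
  have N: "N > 0" using gs(2) by (simp add: N_def prod_pos)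
  \<comment> \<open>\<open>l div N\<close> is the parent of \<open>l\<close> and
    \<open>l mod N\<close> its place among the siblings; the second \<open>mod\<close> cycles
    through the list of the parent.\<close>
  define w' where "w' l = gs (l div N) ! (l mod N mod length (gs (l div N)))" for l
  have w': "w' l \<in> set (gs (l div N))" for l
    unfolding w'_def by (rule nth_mem) (use gs(2) in simp)
  have "\<delta> * norm (\<Sum>i<N. w' (j * N + i) - w j) \<le> (\<Sum>i<N. \<phi> (w' (j * N + i)) - \<phi> (w j) + \<eta>)"
    if "j < m" for j
  proof -
    \<comment> \<open>the number \<open>N\<close> of children is common to all \<open>j\<close>, so the list \<open>gs j\<close> is repeated \<open>q\<close> times\<close>
    have "length (gs j) dvd N" unfolding N_def using that by (intro dvd_prodI) auto
    then obtain q where q: "N = q * length (gs j)" by (metis dvd_def mult.commute)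
    have rep: "(\<Sum>i<N. h (w' (j * N + i))) = real q *\<^sub>R (\<Sum>g\<leftarrow>gs j. h g)" for h :: "'a \<Rightarrow> 'b::real_vector"
    proof -
      have "(\<Sum>i<N. h (w' (j * N + i))) = (\<Sum>i<q * length (gs j). h (gs j ! (i mod length (gs j))))"
        unfolding q[symmetric] by (intro sum.cong) (simp_all add: w'_def)
      also have "\<dots> = real q *\<^sub>R (\<Sum>i<length (gs j). h (gs j ! i))" by (rule sum_mod_repeat)
      also have "(\<Sum>i<length (gs j). h (gs j ! i)) = (\<Sum>g\<leftarrow>gs j. h g)"
        by (simp add: sum_list_sum_nth atLeast0LessThan)
      finally show ?thesis .
    qed
    show ?thesis
      unfolding rep[of "\<lambda>g. g - w j"] rep[of "\<lambda>g. \<phi> g - \<phi> (w j) + \<eta>"]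
      using mult_left_mono[OF less_imp_le[OF gs(3)[of j]], of "real q"] by (simp add: mult.left_commute)
  qed
  moreover have "w' l \<in> C" "\<epsilon> \<le> norm (w' l - w (l div N))" for l
    using w'[of l] gs(1)[of "l div N"] by auto
  ultimately show ?thesis using N by (intro exI[of _ N] exI[of _ w'] conjI) auto
qed

text \<open>Otherwise spreading never stops. The mean \<open>\<Phi>\<close> of \<open>\<phi>\<close>
  over the cells rises in each step by at least \<open>\<delta>\<close> times the drift, up to the
  slack \<open>\<eta> n\<close>. As \<open>\<Phi>\<close> is bounded above, the drifts are summable,
  while all increments have norm at least \<open>\<epsilon>\<close>.\<close>

lemma RNP_imp_small_slice:
  fixes \<phi> :: "'a::banach \<Rightarrow> real"
  assumes rnp: "radon_nikodym_property TYPE('a)"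
    and C: "bounded C" "C \<noteq> {}" and bdd: "bdd_above (\<phi> ` C)" and "\<delta> > 0" "\<epsilon> > 0"
  shows "\<exists>y :: 'a \<Rightarrow>\<^sub>L real. \<exists>f\<in>C. \<exists>\<eta>>0. norm y \<le> \<delta> \<and>
    (\<forall>g\<in>C. \<epsilon> \<le> norm (g - f) \<longrightarrow> \<phi> g + blinfun_apply y g \<le> \<phi> f + blinfun_apply y f - \<eta>)"
proof (rule ccontr)
  assume neg: "\<not> ?thesis"
  have spread: "\<exists>gs. set gs \<subseteq> {g \<in> C. \<epsilon> \<le> norm (g - f)} \<and> gs \<noteq> [] \<and>
      \<delta> * norm (\<Sum>g\<leftarrow>gs. g - f) < (\<Sum>g\<leftarrow>gs. \<phi> g - \<phi> f + \<eta>)" if "f \<in> C" "\<eta> > 0" for f \<eta>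
  proof -
    have "\<nexists>y :: 'a \<Rightarrow>\<^sub>L real. norm y \<le> \<delta> \<and> (\<forall>g\<in>{g \<in> C. \<epsilon> \<le> norm (g - f)}.
        \<phi> g + blinfun_apply y g \<le> \<phi> f + blinfun_apply y f - \<eta>)"
      using neg that by blast
    with tilted_drop_or_spread[OF less_imp_le[OF \<open>\<delta> > 0\<close>]] show ?thesis by blast
  qed
  \<comment> \<open>Positive slacks with total at most 2, so they do not spoil the summability of
    the drifts.\<close>
  define \<eta> :: "nat \<Rightarrow> real" where "\<eta> n = (1 / 2) ^ n" for n
  \<comment> \<open>A state consists of the number of cells and their values; \<open>Q\<close> is
    one refinement with slack \<open>\<eta> n\<close>.\<close>
  define P where "P = (\<lambda>(n::nat) (m::nat, w :: nat \<Rightarrow> 'a). 0 < m \<and> (\<forall>j. w j \<in> C))"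
  define Q where "Q = (\<lambda>(n::nat) (m::nat, w :: nat \<Rightarrow> 'a) (m'::nat, w' :: nat \<Rightarrow> 'a). \<exists>N>0. m' = m * N \<and> (\<forall>l. \<epsilon> \<le> norm (w' l - w (l div N))) \<and>
    (\<forall>j<m. \<delta> * norm (\<Sum>i<N. w' (j * N + i) - w j) \<le> (\<Sum>i<N. \<phi> (w' (j * N + i)) - \<phi> (w j) + \<eta> n)))"
  obtain f0 where "f0 \<in> C" using C(2) by blast
  have "\<exists>X. \<forall>n. P n (X n) \<and> Q n (X n) (X (Suc n))"
  proof (rule dependent_nat_choice)
    show "\<exists>x. P 0 x" using \<open>f0 \<in> C\<close> by (intro exI[of _ "(1, \<lambda>_. f0)"]) (simp add: P_def)
    fix x n assume "P n x"
    then obtain m w where x: "x = (m, w)" and m: "0 < m" and w: "\<And>j. w j \<in> C"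
      by (cases x) (auto simp: P_def)
    obtain N w' where "0 < N" "\<forall>l. w' l \<in> C" "\<forall>l. \<epsilon> \<le> norm (w' l - w (l div N))"
      "\<forall>j<m. \<delta> * norm (\<Sum>i<N. w' (j * N + i) - w j) \<le> (\<Sum>i<N. \<phi> (w' (j * N + i)) - \<phi> (w j) + \<eta> n)"
      using refine_step[of C \<epsilon> \<delta> \<phi> "\<eta> n" w m] spread[of _ "\<eta> n"] w by (auto simp: \<eta>_def)
    then show "\<exists>y. P (Suc n) y \<and> Q n x y"
      using m by (intro exI[of _ "(m * N, w')"]) (auto simp: P_def Q_def x)
  qed
  then obtain X where X: "\<And>n. P n (X n)" "\<And>n. Q n (X n) (X (Suc n))" by blast
  define M where "M n = fst (X n)" for n
  define v where "v n = snd (X n)" for n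
  have M: "M n > 0" and v: "v n j \<in> C" for n j
    using X(1)[of n] by (auto simp: P_def M_def v_def split: prod.splits)
  have "\<exists>N>0. M (Suc n) = M n * N \<and> (\<forall>l. \<epsilon> \<le> norm (v (Suc n) l - v n (l div N))) \<and>
    (\<forall>j<M n. \<delta> * norm (\<Sum>i<N. v (Suc n) (j * N + i) - v n j) \<le> (\<Sum>i<N. \<phi> (v (Suc n) (j * N + i)) - \<phi> (v n j) + \<eta> n))" for n
    using X(2)[of n] by (auto simp: Q_def M_def v_def split: prod.splits)
  then obtain N where N: "\<And>n. N n > 0" and M_Suc: "\<And>n. M (Suc n) = M n * N n"
    and far: "\<And>n l. \<epsilon> \<le> norm (v (Suc n) l - v n (l div N n))"
    and gain: "\<And>n j. j < M n \<Longrightarrow> \<delta> * norm (\<Sum>i<N n. v (Suc n) (j * N n + i) - v n j)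
      \<le> (\<Sum>i<N n. \<phi> (v (Suc n) (j * N n + i)) - \<phi> (v n j) + \<eta> n)"
    by metis
  define d where "d n j = norm ((1 / real (N n)) *\<^sub>R (\<Sum>i<N n. v (Suc n) (j * N n + i)) - v n j)" for n j
  define \<Phi> where "\<Phi> n = (\<Sum>j<M n. \<phi> (v n j)) / real (M n)" for n
  \<comment> \<open>The mean of the children minus the parent is the mean of the increments, so
    dividing the spreading inequality by \<open>N n\<close> bounds the drift.\<close>
  have d: "\<delta> * d n j \<le> (\<Sum>i<N n. \<phi> (v (Suc n) (j * N n + i))) / real (N n) - \<phi> (v n j) + \<eta> n" if "j < M n" for n j
  proof -
    have "(1 / real (N n)) *\<^sub>R (\<Sum>i<N n. v (Suc n) (j * N n + i)) - v n j
      = (1 / real (N n)) *\<^sub>R (\<Sum>i<N n. v (Suc n) (j * N n + i) - v n j)"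
      using N[of n] by (simp add: sum_subtractf scaleR_diff_right sum_constant_scaleR)
    then have "\<delta> * d n j = \<delta> * norm (\<Sum>i<N n. v (Suc n) (j * N n + i) - v n j) / real (N n)"
      by (simp add: d_def)
    also have "\<dots> \<le> (\<Sum>i<N n. \<phi> (v (Suc n) (j * N n + i)) - \<phi> (v n j) + \<eta> n) / real (N n)"
      using gain[OF that] by (rule divide_right_mono) simp
    also have "\<dots> = (\<Sum>i<N n. \<phi> (v (Suc n) (j * N n + i))) / real (N n) - \<phi> (v n j) + \<eta> n"
      using N[of n] by (simp add: sum.distrib sum_subtractf field_simps)
    finally show ?thesis .
  qed
  \<comment> \<open>Averaged over the parents, the means over children become the mean over all
    cells of the next level; the differences of \<open>\<Phi>\<close> then telescope.\<close>
  have E: "\<delta> * ((\<Sum>j<M n. d n j) / real (M n)) \<le> \<Phi> (Suc n) - \<Phi> n + \<eta> n" for n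
  proof -
    have "(\<Sum>l<M (Suc n). \<phi> (v (Suc n) l)) = (\<Sum>j<M n. \<Sum>i<N n. \<phi> (v (Suc n) (j * N n + i)))"
      unfolding M_Suc sum.nat_group[symmetric]
    proof (rule sum.cong[OF refl])
      fix j
      show "(\<Sum>l = j * N n..<j * N n + N n. \<phi> (v (Suc n) l)) = (\<Sum>i<N n. \<phi> (v (Suc n) (j * N n + i)))"
        by (rule sum.reindex_bij_witness[of _ "\<lambda>i. j * N n + i" "\<lambda>l. l - j * N n"]) auto
    qed
    then have \<Phi>: "\<Phi> (Suc n) = (\<Sum>j<M n. (\<Sum>i<N n. \<phi> (v (Suc n) (j * N n + i))) / real (N n)) / real (M n)"
      by (simp add: \<Phi>_def M_Suc sum_divide_distrib mult.commute)
    have "\<delta> * (\<Sum>j<M n. d n j) \<le> (\<Sum>j<M n. (\<Sum>i<N n. \<phi> (v (Suc n) (j * N n + i))) / real (N n) - \<phi> (v n j) + \<eta> n)"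
      unfolding sum_distrib_left using d by (intro sum_mono) auto
    then have "\<delta> * (\<Sum>j<M n. d n j) / real (M n) \<le>
      (\<Sum>j<M n. (\<Sum>i<N n. \<phi> (v (Suc n) (j * N n + i))) / real (N n) - \<phi> (v n j) + \<eta> n) / real (M n)"
      by (rule divide_right_mono) simp
    also have "\<dots> = \<Phi> (Suc n) - \<Phi> n + \<eta> n"
      using M[of n] unfolding \<Phi> \<Phi>_def[of n]
      by (simp add: sum.distrib sum_subtractf add_divide_distrib diff_divide_distrib)
    finally show ?thesis by simp
  qed
  obtain B where B: "\<And>g. g \<in> C \<Longrightarrow> \<phi> g \<le> B" using bdd by (auto simp: bdd_above_def)
  have \<Phi>_le: "\<Phi> n \<le> B" for n
  proof -
    have "(\<Sum>j<M n. \<phi> (v n j)) \<le> (\<Sum>j<M n. B)" using B v by (intro sum_mono) auto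
    then show ?thesis using M[of n] by (simp add: \<Phi>_def pos_divide_le_eq mult.commute)
  qed
  have "summable (\<lambda>n. (\<Sum>j<M n. d n j) / real (M n))"
  proof (rule summableI_nonneg_bounded)
    show "0 \<le> (\<Sum>j<M n. d n j) / real (M n)" for n
      by (intro divide_nonneg_nonneg sum_nonneg) (auto simp: d_def)
    fix k
    have "\<delta> * (\<Sum>n<k. (\<Sum>j<M n. d n j) / real (M n)) \<le> (\<Sum>n<k. \<Phi> (Suc n) - \<Phi> n + \<eta> n)"
      unfolding sum_distrib_left using E by (intro sum_mono)
    also have "\<dots> = \<Phi> k - \<Phi> 0 + (\<Sum>n<k. \<eta> n)"
      by (simp only: sum.distrib sum_lessThan_telescope)
    also have "(\<Sum>n<k. \<eta> n) \<le> 2"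
      unfolding \<eta>_def by (subst geometric_sum) (auto simp: field_simps)
    also have "\<Phi> k - \<Phi> 0 + 2 \<le> B - \<Phi> 0 + 2" using \<Phi>_le by simp
    finally show "(\<Sum>n<k. (\<Sum>j<M n. d n j) / real (M n)) \<le> (B - \<Phi> 0 + 2) / \<delta>"
      using \<open>\<delta> > 0\<close> by (simp add: pos_le_divide_eq mult.commute)
  qed
  then have summ: "summable (\<lambda>n. (\<Sum>j<M n.
      norm ((1 / real (N n)) *\<^sub>R (\<Sum>i<N n. v (Suc n) (j * N n + i)) - v n j)) / real (M n))"
    by (simp only: d_def)
  obtain R where R: "\<And>g. g \<in> C \<Longrightarrow> norm g \<le> R" using C(1) by (auto simp: bounded_iff)
  interpret quasi_martingale M N v R
    by unfold_locales (use M M_Suc R v summ in auto)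
  show False using RNP_imp_small_increment[OF rnp \<open>\<epsilon> > 0\<close>] far by (meson not_le)
qed

text \<open>For \<open>x\<close> in \<open>U \<epsilon>\<close>, all near-maximizers of
  \<open>\<phi> + x\<close> lie within \<open>\<epsilon>\<close> of one point. These sets are open
  and, by small slices, dense. For \<open>x\<close> in the intersection over
  \<open>\<epsilon> = 1 / (n + 1)\<close>, which is dense by Baire, either a maximizer is at hand or
  a maximizing sequence is Cauchy.\<close>

theorem RNP_imp_dense_attained:
  fixes \<phi> :: "'a::banach \<Rightarrow> real"
  assumes rnp: "radon_nikodym_property TYPE('a)"
    and C: "closed C" "bounded C" "C \<noteq> {}" and cont: "continuous_on C \<phi>" and bdd: "bdd_above (\<phi> ` C)"
  shows "closure {x :: 'a \<Rightarrow>\<^sub>L real. \<exists>f\<in>C. \<forall>g\<in>C. \<phi> g + blinfun_apply x g \<le> \<phi> f + blinfun_apply x f} = UNIV"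
proof -
  obtain R where R: "R > 0" "\<And>g. g \<in> C \<Longrightarrow> norm g \<le> R"
    using C(2) by (auto simp: bounded_pos)
  define U where "U \<epsilon> = {x :: 'a \<Rightarrow>\<^sub>L real. \<exists>f\<in>C. \<exists>\<eta>>0. \<forall>g\<in>C. \<epsilon> \<le> norm (g - f) \<longrightarrow>
      \<phi> g + blinfun_apply x g \<le> \<phi> f + blinfun_apply x f - \<eta>}" for \<epsilon>
  have apply_le: "\<bar>blinfun_apply x g\<bar> \<le> norm x * R" if "g \<in> C" for x :: "'a \<Rightarrow>\<^sub>L real" and g
  proof -
    have "\<bar>blinfun_apply x g\<bar> \<le> norm x * norm g" using norm_blinfun[of x g] by simp
    also have "\<dots> \<le> norm x * R" using R(2)[OF that] by (intro mult_left_mono) auto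
    finally show ?thesis .
  qed
  have "open (U \<epsilon>)" for \<epsilon>
    unfolding open_dist
  proof
    fix x assume "x \<in> U \<epsilon>"
    then obtain f \<eta> where f: "f \<in> C" "\<eta> > 0" and x: "\<And>g. g \<in> C \<Longrightarrow> \<epsilon> \<le> norm (g - f) \<Longrightarrow>
      \<phi> g + blinfun_apply x g \<le> \<phi> f + blinfun_apply x f - \<eta>" by (auto simp: U_def)
    show "\<exists>e>0. \<forall>y. dist y x < e \<longrightarrow> y \<in> U \<epsilon>"
    proof (intro exI conjI allI impI)
      \<comment> \<open>At this distance the values at \<open>f\<close> and at \<open>g\<close> each
        move by at most \<open>\<eta> / 4\<close>, so half of the gap survives.\<close>
      show "\<eta> / (4 * R) > 0" using f R by simp
      fix y assume y: "dist y x < \<eta> / (4 * R)"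
      then have "norm (y - x) * R \<le> \<eta> / 4" using R(1) by (simp add: dist_norm field_simps)
      then have close: "\<bar>blinfun_apply y g - blinfun_apply x g\<bar> \<le> \<eta> / 4" if "g \<in> C" for g
        using apply_le[OF that, of "y - x"] by (simp add: blinfun.diff_left)
      have "\<phi> g + blinfun_apply y g \<le> \<phi> f + blinfun_apply y f - \<eta> / 2" if "g \<in> C" "\<epsilon> \<le> norm (g - f)" for g
        using x[OF that] close[OF that(1)] close[OF f(1)] by linarith
      then show "y \<in> U \<epsilon>" unfolding U_def using f by (auto intro!: bexI[of _ f] exI[of _ "\<eta> / 2"])
    qed
  qed
  moreover have "closure (U \<epsilon>) = UNIV" if "\<epsilon> > 0" for \<epsilon>
  proof -
    have "x \<in> closure (U \<epsilon>)" for x :: "'a \<Rightarrow>\<^sub>L real"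
      unfolding closure_approachable
    proof (intro allI impI)
      fix \<theta> :: real assume "\<theta> > 0"
      obtain B where B: "\<And>g. g \<in> C \<Longrightarrow> \<phi> g \<le> B" using bdd by (auto simp: bdd_above_def)
      have "bdd_above ((\<lambda>g. \<phi> g + blinfun_apply x g) ` C)"
      proof (rule bdd_aboveI2)
        show "\<phi> g + blinfun_apply x g \<le> B + norm x * R" if "g \<in> C" for g
          using B[OF that] apply_le[OF that, of x] by linarith
      qed
      \<comment> \<open>Density near \<open>x\<close>: the slice result is applied to
        \<open>\<phi> + x\<close>, which is still bounded above on \<open>C\<close>.\<close>
      from RNP_imp_small_slice[OF rnp C(2,3) this half_gt_zero[OF \<open>\<theta> > 0\<close>] \<open>\<epsilon> > 0\<close>]
      obtain y :: "'a \<Rightarrow>\<^sub>L real" and f \<eta> where y: "f \<in> C" "\<eta> > 0" "norm y \<le> \<theta> / 2"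
        "\<forall>g\<in>C. \<epsilon> \<le> norm (g - f) \<longrightarrow>
          \<phi> g + blinfun_apply x g + blinfun_apply y g \<le> \<phi> f + blinfun_apply x f + blinfun_apply y f - \<eta>"
        by blast
      have "x + y \<in> U \<epsilon>"
        unfolding U_def using y(1,2,4) by (auto simp: blinfun.add_left add.assoc intro!: bexI[of _ f] exI[of _ \<eta>])
      moreover have "dist (x + y) x < \<theta>" using y(3) \<open>\<theta> > 0\<close> by (simp add: dist_norm)
      ultimately show "\<exists>z\<in>U \<epsilon>. dist z x < \<theta>" by blast
    qed
    then show ?thesis by auto
  qed
  ultimately have "euclidean closure_of \<Inter>(range (\<lambda>n. U (inverse (real (Suc n))))) = topspace euclidean"
    using completely_metrizable_space_euclidean
    by (intro Baire_category) (auto simp: euclidean_closure_of)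
  then have dense: "closure (\<Inter>n. U (inverse (real (Suc n)))) = UNIV" by (simp add: euclidean_closure_of)
  have "(\<Inter>n. U (inverse (real (Suc n)))) \<subseteq> {x. \<exists>f\<in>C. \<forall>g\<in>C. \<phi> g + blinfun_apply x g \<le> \<phi> f + blinfun_apply x f}"
  proof
    fix x assume x: "x \<in> (\<Inter>n. U (inverse (real (Suc n))))"
    define \<psi> where "\<psi> g = \<phi> g + blinfun_apply x g" for g
    have "\<exists>f. f \<in> C \<and> (\<forall>g\<in>C. inverse (real (Suc n)) \<le> norm (g - f) \<longrightarrow> \<psi> g < \<psi> f)" for n
    proof -
      have "x \<in> U (inverse (real (Suc n)))" using x by blast
      then obtain f \<eta> where f: "f \<in> C" "\<eta> > 0" and drop: "\<forall>g\<in>C. inverse (real (Suc n)) \<le> norm (g - f) \<longrightarrow>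
          \<phi> g + blinfun_apply x g \<le> \<phi> f + blinfun_apply x f - \<eta>"
        unfolding U_def by blast
      have "\<psi> g < \<psi> f" if "g \<in> C" "inverse (real (Suc n)) \<le> norm (g - f)" for g
        using bspec[OF drop that(1)] that(2) f(2) unfolding \<psi>_def by linarith
      with f(1) show ?thesis by blast
    qed
    then have "\<forall>n. \<exists>f. f \<in> C \<and> (\<forall>g\<in>C. inverse (real (Suc n)) \<le> norm (g - f) \<longrightarrow> \<psi> g < \<psi> f)" ..
    from choice[OF this] obtain f where f: "\<And>n. f n \<in> C"
      "\<And>n g. g \<in> C \<Longrightarrow> inverse (real (Suc n)) \<le> norm (g - f n) \<Longrightarrow> \<psi> g < \<psi> (f n)"
      by blast
    show "x \<in> {x. \<exists>f\<in>C. \<forall>g\<in>C. \<phi> g + blinfun_apply x g \<le> \<phi> f + blinfun_apply x f}"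
    proof (cases "\<exists>n. \<forall>g\<in>C. \<psi> g \<le> \<psi> (f n)")
      case True
      then show ?thesis using f(1) by (auto simp: \<psi>_def)
    next
      case False
      \<comment> \<open>No \<open>f n\<close> is a maximizer, so every \<open>\<psi> (f n)\<close>
        is below the supremum. A maximizing sequence eventually exceeds it and hence stays within
        \<open>1 / (n + 1)\<close> of \<open>f n\<close>.\<close>
      define s where "s = (SUP g\<in>C. \<psi> g)"
      have bdd': "bdd_above (\<psi> ` C)"
      proof -
        obtain B where B: "\<And>g. g \<in> C \<Longrightarrow> \<phi> g \<le> B" using bdd by (auto simp: bdd_above_def)
        show ?thesis
        proof (rule bdd_aboveI2)
          show "\<psi> g \<le> B + norm x * R" if "g \<in> C" for g
            using B[OF that] apply_le[OF that, of x] unfolding \<psi>_def by linarith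
        qed
      qed
      have le_s: "\<psi> g \<le> s" if "g \<in> C" for g unfolding s_def using that bdd' by (rule cSUP_upper)
      have less_s: "\<psi> (f n) < s" for n using False le_s by (meson not_le less_le_trans)
      have "\<exists>g\<in>C. s - inverse (real (Suc k)) < \<psi> g" for k
      proof -
        have "s - inverse (real (Suc k)) < s" by simp
        then show ?thesis using less_cSUP_iff[OF C(3) bdd'] unfolding s_def by blast
      qed
      then obtain g where g: "\<And>k. g k \<in> C" "\<And>k. s - inverse (real (Suc k)) < \<psi> (g k)" by metis
      have lim: "(\<lambda>k. \<psi> (g k)) \<longlonglongrightarrow> s"
      proof (rule tendsto_sandwich[of "\<lambda>k. s - inverse (real (Suc k))" _ _ "\<lambda>_. s"])
        show "(\<lambda>k. s - inverse (real (Suc k))) \<longlonglongrightarrow> s"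
          using tendsto_diff[OF tendsto_const LIMSEQ_inverse_real_of_nat, of s] by simp
      qed (use g le_s in \<open>auto intro: always_eventually less_imp_le\<close>)
      have "Cauchy g"
      proof (rule metric_CauchyI)
        fix e :: real assume "e > 0"
        then obtain n where n: "inverse (real (Suc n)) < e / 2" using reals_Archimedean[of "e / 2"] by auto
        have "\<forall>\<^sub>F k in sequentially. \<psi> (f n) < \<psi> (g k)" using lim less_s by (rule order_tendstoD(1))
        then obtain K where K: "\<And>k. k \<ge> K \<Longrightarrow> \<psi> (f n) < \<psi> (g k)" by (auto simp: eventually_sequentially)
        have "dist (g k) (f n) < e / 2" if "k \<ge> K" for k
          using f(2)[OF g(1)[of k], of n] K[OF that] n unfolding dist_norm by linarith
        then show "\<exists>K. \<forall>m\<ge>K. \<forall>n\<ge>K. dist (g m) (g n) < e"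
          by (meson dist_triangle_half_l)
      qed
      then obtain g0 where g0: "g \<longlonglongrightarrow> g0" using Cauchy_convergent_iff convergent_def by blast
      have "g0 \<in> C" using C(1) g(1) g0 by (rule closed_sequentially)
      have "continuous_on C \<psi>" unfolding \<psi>_def by (intro continuous_intros cont)
      then have "(\<lambda>k. \<psi> (g k)) \<longlonglongrightarrow> \<psi> g0"
        using g(1) g0 \<open>g0 \<in> C\<close> by (intro continuous_on_tendsto_compose[of C \<psi> g]) auto
      then have "\<psi> g0 = s" using lim LIMSEQ_unique by blast
      then show ?thesis using le_s \<open>g0 \<in> C\<close> by (auto simp: \<psi>_def)
    qed
  qed
  then show ?thesis using dense closure_mono by blast
qed

section \<open>The weak* topology and farthest points\<close>

lemma Hausdorff_weak_star: "Hausdorff_space (weak_star :: ('a::real_normed_vector \<Rightarrow>\<^sub>L real) topology)"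
  unfolding Hausdorff_space_def
proof (intro allI impI)
  fix z w :: "'a \<Rightarrow>\<^sub>L real"
  assume "z \<in> topspace weak_star \<and> w \<in> topspace weak_star \<and> z \<noteq> w"
  then obtain x where "blinfun_apply z x \<noteq> blinfun_apply w x" by (metis blinfun_eqI)
  then obtain U V where UV: "open U" "open V" "blinfun_apply z x \<in> U" "blinfun_apply w x \<in> V" "U \<inter> V = {}"
    using hausdorff by metis
  \<comment> \<open>The one-element index set puts a single evaluation into the form of a basic open
    set.\<close>
  have "openin weak_star {f. \<forall>i\<in>{()}. blinfun_apply f x \<in> U}" "openin weak_star {f. \<forall>i\<in>{()}. blinfun_apply f x \<in> V}"
    using UV by (intro strong_operator_topology_basis; simp)+
  with UV show "\<exists>U V. openin weak_star U \<and> openin weak_star V \<and> z \<in> U \<and> w \<in> V \<and> disjnt U V"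
    by (intro exI[of _ "{f. \<forall>i\<in>{()}. blinfun_apply f x \<in> U}"] exI[of _ "{f. \<forall>i\<in>{()}. blinfun_apply f x \<in> V}"])
      (auto simp: disjnt_def)
qed

lemma closedin_weak_star_imp_closed: "closedin weak_star K \<Longrightarrow> closed K"
  using closedin_continuous_map_preimage[OF strong_operator_topology_weaker_than_euclidean, of K]
  by simp

text \<open>As plain functions, the members of the ball form a closed subset of a product of compact
  intervals, which is compact by Tychonoff; \<open>Blinfun\<close> carries it continuously onto the
  ball.\<close>

lemma Banach_Alaoglu: "compactin weak_star (cball (0 :: 'a::real_normed_vector \<Rightarrow>\<^sub>L real) R)"
proof (cases "R < 0")
  case False
  define H where "H = {h :: 'a \<Rightarrow> real. (\<forall>x. \<bar>h x\<bar> \<le> R * norm x) \<and>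
    (\<forall>x y. h (x + y) = h x + h y) \<and> (\<forall>r x. h (r *\<^sub>R x) = r * h x)}"
  have H: "bounded_linear h" if "h \<in> H" for h
    using that by (intro bounded_linear_intro[of h R]) (auto simp: H_def mult.commute)
  have "compactin (product_topology (\<lambda>_. euclidean) UNIV) (PiE UNIV (\<lambda>x::'a. cball (0::real) (R * norm x)))"
    by (subst compactin_PiE) auto
  then have "compact (PiE UNIV (\<lambda>x::'a. cball (0::real) (R * norm x)))"
    by (simp add: euclidean_product_topology)
  moreover have "closed {h :: 'a \<Rightarrow> real. (\<forall>x y. h (x + y) = h x + h y) \<and> (\<forall>r x. h (r *\<^sub>R x) = r * h x)}"
    by (intro closed_Collect_conj closed_Collect_all closed_Collect_eq continuous_intros continuous_on_product_coordinates)
  moreover have "H = PiE UNIV (\<lambda>x::'a. cball (0::real) (R * norm x)) \<inter>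
      {h. (\<forall>x y. h (x + y) = h x + h y) \<and> (\<forall>r x. h (r *\<^sub>R x) = r * h x)}"
    by (auto simp: H_def PiE_def Pi_def)
  ultimately have "compact H" by (simp add: compact_Int_closed)
  have "continuous_map (top_of_set H) weak_star Blinfun"
    unfolding continuous_on_strong_operator_topo_iff_coordinatewise
  proof
    fix x
    have "continuous_on H (\<lambda>h. h x)" by (rule continuous_on_subset[OF continuous_on_product_coordinates]) simp
    moreover have "blinfun_apply (Blinfun h) x = h x" if "h \<in> H" for h
      by (simp add: bounded_linear_Blinfun_apply H[OF that])
    ultimately have "continuous_on H (\<lambda>h. blinfun_apply (Blinfun h) x)" by (simp cong: continuous_on_cong)
    then show "continuous_map (top_of_set H) euclidean (\<lambda>h. blinfun_apply (Blinfun h) x)" by simp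
  qed
  then have "compactin weak_star (Blinfun ` H)"
    by (rule image_compactin[rotated]) (simp add: compactin_subtopology \<open>compact H\<close>)
  moreover have "Blinfun ` H = cball 0 R"
  proof
    show "Blinfun ` H \<subseteq> cball 0 R"
    proof
      fix z assume "z \<in> Blinfun ` H"
      then obtain h where h: "h \<in> H" "z = Blinfun h" by blast
      have "norm z \<le> R"
        using False h by (intro norm_blinfun_bound) (auto simp: bounded_linear_Blinfun_apply H, simp add: H_def)
      then show "z \<in> cball 0 R" by simp
    qed
    show "cball 0 R \<subseteq> Blinfun ` H"
    proof
      fix z :: "'a \<Rightarrow>\<^sub>L real" assume "z \<in> cball 0 R"
      then have "norm (blinfun_apply z x) \<le> R * norm x" for x
        using norm_blinfun[of z x] mult_right_mono[of "norm z" R "norm x"] by simp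
      then have "blinfun_apply z \<in> H" by (simp add: H_def blinfun.add_right blinfun.scaleR_right)
      then show "z \<in> Blinfun ` H" by (intro image_eqI[of _ _ "blinfun_apply z"]) (simp_all add: blinfun_apply_inverse)
    qed
  qed
  ultimately show ?thesis by simp
qed simp

lemma bounded_closedin_weak_star_imp_compactin:
  assumes "bounded K" "closedin weak_star K"
  shows "compactin weak_star (K :: ('a::real_normed_vector \<Rightarrow>\<^sub>L real) set)"
proof -
  obtain R where "\<forall>z\<in>K. norm z \<le> R" using assms(1) by (auto simp: bounded_iff)
  then have "K \<subseteq> cball 0 R" by auto
  then show ?thesis using closed_compactin[OF Banach_Alaoglu _ assms(2)] by blast
qed

text \<open>Uniform boundedness by Baire: weak* compactness gives pointwise bounds, so the closed
  sets \<open>F n\<close> cover the space and one of them contains a ball.\<close>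

lemma compactin_weak_star_imp_bounded:
  assumes K: "compactin weak_star (K :: ('a::banach \<Rightarrow>\<^sub>L real) set)"
  shows "bounded K"
proof -
  define F where "F n = {x :: 'a. \<forall>z\<in>K. \<bar>blinfun_apply z x\<bar> \<le> real n}" for n
  have closed: "closed (F n)" for n
    unfolding F_def Ball_def
    by (intro closed_Collect_all closed_Collect_imp closed_Collect_le open_Collect_const continuous_intros)
  have "\<exists>n. x \<in> F n" for x
  proof -
    have "compactin euclidean ((\<lambda>z. blinfun_apply z x) ` K)"
      by (rule image_compactin[OF K strong_operator_topology_continuous_evaluation])
    then have "bounded ((\<lambda>z. blinfun_apply z x) ` K)" by (simp add: compact_imp_bounded)
    then obtain b where "\<forall>z\<in>K. \<bar>blinfun_apply z x\<bar> \<le> b" by (auto simp: bounded_iff)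
    moreover obtain n where "b \<le> real n" using real_arch_simple by blast
    ultimately show ?thesis unfolding F_def by (auto intro!: exI[of _ n] intro: order_trans)
  qed
  then have "\<Union>(range F) = UNIV" by auto
  moreover have "euclidean interior_of \<Union>(range F) = {}" if "\<And>n. interior (F n) = {}"
    using that closed by (intro Baire_category_alt) (auto simp: completely_metrizable_space_euclidean)
  ultimately obtain n where "interior (F n) \<noteq> {}" by auto
  then obtain x0 r where r: "r > 0" and ball: "cball x0 r \<subseteq> F n"
    by (metis all_not_in_conv mem_interior_cball)
  have "norm z \<le> 2 * real n / r" if z: "z \<in> K" for z
  proof (rule norm_blinfun_bound)
    fix u
    show "norm (blinfun_apply z u) \<le> 2 * real n / r * norm u"
    proof (cases "u = 0")
      case False
      \<comment> \<open>Scales \<open>u\<close> to length \<open>r\<close>, so that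
        \<open>x0\<close> and \<open>x0 + t *\<^sub>R u\<close> both lie in the ball; the values
        there differ by at most \<open>2 * real n\<close>.\<close>
      define t where "t = r / norm u"
      have "t > 0" using False r by (simp add: t_def)
      have "norm (t *\<^sub>R u) = r" using False r by (simp add: t_def)
      then have "x0 + t *\<^sub>R u \<in> F n" "x0 \<in> F n" using ball r by (auto simp: dist_norm)
      then have "\<bar>blinfun_apply z (x0 + t *\<^sub>R u)\<bar> \<le> real n" "\<bar>blinfun_apply z x0\<bar> \<le> real n"
        using z by (auto simp: F_def)
      then have "\<bar>t * blinfun_apply z u\<bar> \<le> 2 * real n" by (simp add: blinfun.add_right blinfun.scaleR_right)
      then have "t * \<bar>blinfun_apply z u\<bar> \<le> 2 * real n" using \<open>t > 0\<close> by (simp add: abs_mult)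
      then show ?thesis using False r by (simp add: t_def field_simps)
    qed simp
  qed (use r in simp)
  then show ?thesis by (auto simp: bounded_iff)
qed

lemma continuous_map_weak_star_affine:
  "continuous_map weak_star weak_star (\<lambda>z :: 'a::real_normed_vector \<Rightarrow>\<^sub>L real. s *\<^sub>R z + w)"
  unfolding continuous_on_strong_operator_topo_iff_coordinatewise blinfun.add_left blinfun.scaleR_left real_scaleR_def
  by (intro allI continuous_map_add continuous_map_real_mult_left strong_operator_topology_continuous_evaluation) simp

text \<open>Affine maps of one point are weak* continuous, so the endpoints of a segment are moved
  from \<open>A\<close> into the closure one after the other.\<close>

lemma convex_weak_star_closure_of:
  assumes "convex (A :: ('a::real_normed_vector \<Rightarrow>\<^sub>L real) set)"
  shows "convex (weak_star closure_of A)"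
proof -
  let ?cl = "weak_star closure_of A"
  have affine_closure: "s *\<^sub>R z + w \<in> ?cl" if B: "\<And>b. b \<in> A \<Longrightarrow> s *\<^sub>R b + w \<in> ?cl" and z: "z \<in> ?cl" for s z w
  proof -
    have "s *\<^sub>R z + w \<in> (\<lambda>z. s *\<^sub>R z + w) ` ?cl" using z by blast
    also have "\<dots> \<subseteq> weak_star closure_of ((\<lambda>z. s *\<^sub>R z + w) ` A)"
      by (rule continuous_map_image_closure_subset[OF continuous_map_weak_star_affine])
    also have "\<dots> \<subseteq> weak_star closure_of ?cl" using B by (intro closure_of_mono) auto
    finally show ?thesis by simp
  qed
  have sub: "A \<subseteq> ?cl" by (rule closure_of_subset) (simp add: strong_operator_topology_topspace)
  show ?thesis
  proof (rule convexI)
    fix x y :: "'a \<Rightarrow>\<^sub>L real" and u v :: real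
    assume x: "x \<in> ?cl" and y: "y \<in> ?cl" and uv: "0 \<le> u" "0 \<le> v" "u + v = 1"
    have "u *\<^sub>R x + v *\<^sub>R b \<in> ?cl" if "b \<in> A" for b
    proof (rule affine_closure[OF _ x])
      show "u *\<^sub>R a + v *\<^sub>R b \<in> ?cl" if "a \<in> A" for a
        using convexD[OF assms that \<open>b \<in> A\<close> uv] sub by blast
    qed
    then have "v *\<^sub>R y + u *\<^sub>R x \<in> ?cl" by (intro affine_closure[OF _ y]) (simp add: add.commute)
    then show "u *\<^sub>R x + v *\<^sub>R y \<in> ?cl" by (simp add: add.commute)
  qed
qed

section \<open>Farthest points and the forward implication\<close>

lemma farthest_points_from_eq:
  assumes "z \<in> K" "\<And>w. w \<in> K \<Longrightarrow> norm (w - x) \<le> norm (z - x)"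
  shows "z \<in> farthest_points_from K x"
proof -
  have "(SUP w\<in>K. norm (w - x)) = norm (z - x)"
    using assms by (intro cSup_eq_maximum) auto
  with assms(1) show ?thesis by (simp add: farthest_points_from_def farthest_radius_def)
qed

lemma norm_le_farthest_radius:
  assumes "bounded K" "w \<in> K"
  shows "norm (w - x) \<le> farthest_radius K x"
proof -
  obtain B where "\<And>z. z \<in> K \<Longrightarrow> norm z \<le> B" using assms(1) by (auto simp: bounded_iff)
  then have "bdd_above ((\<lambda>z. norm (z - x)) ` K)"
    by (intro bdd_aboveI2[of _ _ "B + norm x"]) (meson add_right_mono norm_triangle_ineq4 order_trans)
  then show ?thesis unfolding farthest_radius_def by (intro cSUP_upper assms)
qed

text \<open>\<open>m f\<close> minimizes evaluation at \<open>f\<close> over \<open>K\<close>. If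
  \<open>\<phi> + x\<close> is maximal at \<open>f\<close>, then \<open>(x - w) g \<le> \<phi> g + x
  g \<le> (x - m f) f \<le> norm (x - m f)\<close> for \<open>w\<close> in \<open>K\<close> and
  \<open>g\<close> in the unit ball; the supremum over \<open>g\<close> shows that
  \<open>m f\<close> is farthest from \<open>x\<close>.\<close>

lemma RNP_imp_dense_farthest_points_from:
  fixes K :: "('a::banach \<Rightarrow>\<^sub>L real) set"
  assumes rnp: "radon_nikodym_property TYPE('a)" and K: "compactin weak_star K" "K \<noteq> {}"
  shows "closure {x. farthest_points_from K x \<noteq> {}} = UNIV"
proof -
  obtain R where R: "\<And>z. z \<in> K \<Longrightarrow> norm z \<le> R"
    using compactin_weak_star_imp_bounded[OF K(1)] by (auto simp: bounded_iff)
  have "\<exists>z\<in>K. \<forall>w\<in>K. blinfun_apply z f \<le> blinfun_apply w f" for f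
  proof -
    have "compactin euclidean ((\<lambda>z. blinfun_apply z f) ` K)"
      by (rule image_compactin[OF K(1) strong_operator_topology_continuous_evaluation])
    then have "compact ((\<lambda>z. blinfun_apply z f) ` K)" by simp
    from compact_attains_inf[OF this] K(2) show ?thesis by auto
  qed
  then obtain m where m: "\<And>f. m f \<in> K" "\<And>f w. w \<in> K \<Longrightarrow> blinfun_apply (m f) f \<le> blinfun_apply w f"
    by metis
  define \<phi> where "\<phi> f = - blinfun_apply (m f) f" for f
  have R0: "R \<ge> 0" using R[OF m(1)] norm_ge_zero order_trans by blast
  have lip: "\<phi> f - \<phi> g \<le> R * norm (f - g)" for f g
  proof -
    have "\<phi> f - \<phi> g \<le> blinfun_apply (m f) (g - f)"
      using m(2)[OF m(1)[of f], of g] by (simp add: \<phi>_def blinfun.diff_right)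
    also have "\<dots> \<le> norm (m f) * norm (g - f)" using norm_blinfun[of "m f" "g - f"] by simp
    also have "\<dots> \<le> R * norm (f - g)" using R[OF m(1)] by (simp add: norm_minus_commute mult_right_mono)
    finally show ?thesis .
  qed
  have "continuous_on (cball 0 1) \<phi>"
  proof (rule lipschitz_on_continuous_on)
    show "R-lipschitz_on (cball 0 1) \<phi>"
    proof (rule lipschitz_onI[OF _ R0])
      show "dist (\<phi> f) (\<phi> g) \<le> R * dist f g" for f g
        using lip[of f g] lip[of g f] by (simp add: dist_norm norm_minus_commute abs_le_iff)
    qed
  qed
  moreover have "bdd_above (\<phi> ` cball 0 1)"
  proof (rule bdd_aboveI2)
    fix f :: 'a assume "f \<in> cball 0 1"
    then have "R * norm (f - 0) \<le> R * 1" using R0 by (intro mult_left_mono) auto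
    then show "\<phi> f \<le> \<phi> 0 + R" using lip[of f 0] by simp
  qed
  ultimately have dense: "closure {x :: 'a \<Rightarrow>\<^sub>L real. \<exists>f\<in>cball 0 1. \<forall>g\<in>cball 0 1.
      \<phi> g + blinfun_apply x g \<le> \<phi> f + blinfun_apply x f} = UNIV"
    by (intro RNP_imp_dense_attained rnp) auto
  have "farthest_points_from K x \<noteq> {}"
    if f: "f \<in> cball 0 1" and max: "\<And>g. g \<in> cball 0 1 \<Longrightarrow> \<phi> g + blinfun_apply x g \<le> \<phi> f + blinfun_apply x f" for x f
  proof -
    have "norm (w - x) \<le> norm (m f - x)" if w: "w \<in> K" for w
    proof -
      have unit: "blinfun_apply (x - w) g \<le> norm (m f - x)" if g: "g \<in> cball 0 1" for g
      proof -
        have "blinfun_apply (x - w) g \<le> \<phi> g + blinfun_apply x g"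
          using m(2)[OF w, of g] by (simp add: \<phi>_def blinfun.diff_left)
        also have "\<dots> \<le> blinfun_apply (x - m f) f" using max[OF g] by (simp add: \<phi>_def blinfun.diff_left)
        also have "\<dots> \<le> norm (x - m f) * norm f" using norm_blinfun[of "x - m f" f] by simp
        also have "\<dots> \<le> norm (x - m f) * 1" using f by (intro mult_left_mono) auto
        finally show ?thesis by (simp add: norm_minus_commute)
      qed
      have "norm (x - w) \<le> norm (m f - x)"
      proof (rule norm_blinfun_bound)
        fix u :: 'a
        show "norm (blinfun_apply (x - w) u) \<le> norm (m f - x) * norm u"
        proof (cases "u = 0")
          case False
          have "blinfun_apply (x - w) (u /\<^sub>R norm u) \<le> norm (m f - x)"
            "blinfun_apply (x - w) (- (u /\<^sub>R norm u)) \<le> norm (m f - x)"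
            using False by (intro unit; simp)+
          then have "\<bar>blinfun_apply (x - w) u / norm u\<bar> \<le> norm (m f - x)"
            by (simp add: blinfun.scaleR_right blinfun.minus_right abs_le_iff field_simps)
          then show ?thesis using False by (simp add: abs_divide pos_divide_le_eq)
        qed simp
      qed simp
      then show ?thesis by (simp add: norm_minus_commute)
    qed
    then show ?thesis using farthest_points_from_eq[OF m(1)[of f]] by blast
  qed
  then have "{x :: 'a \<Rightarrow>\<^sub>L real. \<exists>f\<in>cball 0 1. \<forall>g\<in>cball 0 1.
      \<phi> g + blinfun_apply x g \<le> \<phi> f + blinfun_apply x f} \<subseteq> {x. farthest_points_from K x \<noteq> {}}" by blast
  then show ?thesis using dense closure_mono by blast
qed

lemma admissible_exclude_point:
  assumes "admissible A" "z \<notin> A"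
  obtains x r where "A \<subseteq> cball x r" "r < norm (z - x)"
proof -
  have "z \<notin> \<Inter>{cball x r |x r. r > 0 \<and> A \<subseteq> cball x r}"
    using assms unfolding admissible_def by simp
  then obtain x r where "A \<subseteq> cball x r" "z \<notin> cball x r" by blast
  then show thesis using that by (auto simp: dist_norm norm_minus_commute not_le)
qed

lemma weak_star_MIP_imp_farthest_points_generate:
  fixes K :: "('a::banach \<Rightarrow>\<^sub>L real) set"
  assumes rnp: "radon_nikodym_property TYPE('a)" and mip: "weak_star_MIP TYPE('a)"
    and K: "K \<noteq> {}" "compactin weak_star K" "convex K"
  shows "K = weak_star closure_of (convex hull (farthest_points K))"
proof -
  let ?L = "weak_star closure_of (convex hull (farthest_points K))"
  have bounded: "bounded K" using K(2) by (rule compactin_weak_star_imp_bounded)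
  have closed: "closedin weak_star K" using compactin_imp_closedin[OF Hausdorff_weak_star K(2)] .
  have "farthest_points K \<subseteq> K" by (auto simp: farthest_points_def farthest_points_from_def)
  then have "convex hull (farthest_points K) \<subseteq> K" using K(3) by (rule hull_minimal)
  then have LK: "?L \<subseteq> K" using closed by (rule closure_of_minimal)
  have fL: "farthest_points K \<subseteq> ?L"
    using hull_subset closure_of_subset[of "convex hull (farthest_points K)" weak_star]
    by (metis strong_operator_topology_topspace subset_UNIV order_trans)
  note dense = RNP_imp_dense_farthest_points_from[OF rnp K(2,1)]
  have near: "\<exists>x'. dist x' x < e \<and> farthest_points_from K x' \<noteq> {}" if "e > 0" for x e
    using closure_approachable[of x "{x. farthest_points_from K x \<noteq> {}}"] dense that by auto
  \<comment> \<open>Density also supplies at least one farthest point; centre 0 and radius 1 are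
    arbitrary.\<close>
  have "?L \<noteq> {}" using near[of 1 0] fL by (fastforce simp: farthest_points_def)
  moreover have "bounded ?L" using bounded LK by (rule bounded_subset)
  moreover have "convex ?L" by (intro convex_weak_star_closure_of convex_convex_hull)
  ultimately have adm: "admissible ?L" using mip by (simp add: weak_star_MIP_def)
  have "K \<subseteq> ?L"
  proof (rule ccontr)
    assume "\<not> K \<subseteq> ?L"
    then obtain z0 where z0: "z0 \<in> K" "z0 \<notin> ?L" by blast
    obtain x r where ball: "?L \<subseteq> cball x r" and far: "r < norm (z0 - x)"
      using adm z0(2) by (rule admissible_exclude_point)
    \<comment> \<open>Half the gap suffices: moving the centre costs \<open>dist x' x\<close> once
      for \<open>z\<close> and once for \<open>z0\<close>.\<close>
    then obtain x' z where x': "dist x' x < (norm (z0 - x) - r) / 2" and z: "z \<in> farthest_points_from K x'"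
      using near[of "(norm (z0 - x) - r) / 2" x] by auto
    have "z \<in> ?L" using z fL by (auto simp: farthest_points_def)
    then have "norm (z - x) \<le> r" using ball by (auto simp: dist_norm norm_minus_commute)
    moreover have "norm (z0 - x') \<le> norm (z - x')"
      using z norm_le_farthest_radius[OF bounded z0(1), of x'] by (simp add: farthest_points_from_def)
    moreover have "norm (z - x') \<le> norm (z - x) + dist x' x" "norm (z0 - x) \<le> norm (z0 - x') + dist x' x"
      by (metis dist_norm dist_triangle dist_commute)+
    ultimately show False using x' by simp
  qed
  with LK show ?thesis by blast
qed

section \<open>Thickened sets, added points and the converse implication\<close>

lemma compactin_weak_star_plus_cball:
  fixes K :: "('a::real_normed_vector \<Rightarrow>\<^sub>L real) set"
  assumes "compactin weak_star K"
  shows "compactin weak_star ((\<lambda>(k, u). k + u) ` (K \<times> cball 0 e))"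
proof (rule image_compactin)
  show "compactin (prod_topology weak_star weak_star) (K \<times> cball 0 e)"
    by (simp add: compactin_Times assms Banach_Alaoglu)
  show "continuous_map (prod_topology weak_star weak_star) weak_star (\<lambda>(k, u). k + u)"
    unfolding continuous_on_strong_operator_topo_iff_coordinatewise case_prod_beta blinfun.add_left
    by (intro allI continuous_map_add
      continuous_map_compose[OF continuous_map_fst strong_operator_topology_continuous_evaluation, unfolded comp_def]
      continuous_map_compose[OF continuous_map_snd strong_operator_topology_continuous_evaluation, unfolded comp_def])
qed

text \<open>As \<open>L\<close> is convex, the hull is the union of the segments from
  \<open>z\<close> to \<open>L\<close>, an image of the compact set
  \<open>{0..1} \<times> L\<close>.\<close>

lemma compactin_weak_star_convex_hull_insert:
  fixes L :: "('a::real_normed_vector \<Rightarrow>\<^sub>L real) set"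
  assumes L: "compactin weak_star L" "convex L" "L \<noteq> {}"
  shows "compactin weak_star (convex hull (insert z L))"
proof -
  have "convex hull (insert z L) = (\<lambda>(t, k). (1 - t) *\<^sub>R z + t *\<^sub>R k) ` ({0..1} \<times> L)"
    unfolding convex_hull_insert[OF L(3)] hull_same[of convex, OF L(2)]
  proof (intro set_eqI iffI)
    fix x assume "x \<in> {x. \<exists>u\<ge>0. \<exists>v\<ge>0. \<exists>b. u + v = 1 \<and> b \<in> L \<and> x = u *\<^sub>R z + v *\<^sub>R b}"
    then obtain u v b where "u \<ge> 0" "v \<ge> 0" "u + v = 1" "b \<in> L" "x = u *\<^sub>R z + v *\<^sub>R b" by blast
    then show "x \<in> (\<lambda>(t, k). (1 - t) *\<^sub>R z + t *\<^sub>R k) ` ({0..1} \<times> L)"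
      by (intro image_eqI[of _ _ "(v, b)"]) (auto simp: eq_diff_eq[symmetric])
  next
    fix x assume "x \<in> (\<lambda>(t, k). (1 - t) *\<^sub>R z + t *\<^sub>R k) ` ({0..1} \<times> L)"
    then obtain t k where "t \<in> {0..1}" "k \<in> L" "x = (1 - t) *\<^sub>R z + t *\<^sub>R k" by auto
    then show "x \<in> {x. \<exists>u\<ge>0. \<exists>v\<ge>0. \<exists>b. u + v = 1 \<and> b \<in> L \<and> x = u *\<^sub>R z + v *\<^sub>R b}"
      by (intro CollectI exI[of _ "1 - t"] exI[of _ t] exI[of _ k] conjI) auto
  qed
  moreover have "compactin weak_star ((\<lambda>(t, k). (1 - t) *\<^sub>R z + t *\<^sub>R k) ` ({0..1::real} \<times> L))"
  proof (rule image_compactin)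
    show "compactin (prod_topology euclidean weak_star) ({0..1::real} \<times> L)"
      using L(1) by (simp add: compactin_Times)
    show "continuous_map (prod_topology euclidean weak_star) weak_star (\<lambda>(t, k). (1 - t) *\<^sub>R z + t *\<^sub>R k)"
      unfolding continuous_on_strong_operator_topo_iff_coordinatewise case_prod_beta blinfun.add_left
        blinfun.scaleR_left real_scaleR_def
      by (intro allI continuous_map_add continuous_map_real_mult continuous_map_diff continuous_map_fst
        continuous_map_compose[OF continuous_map_snd strong_operator_topology_continuous_evaluation, unfolded comp_def])
        auto
  qed
  ultimately show ?thesis by simp
qed

text \<open>If \<open>z\<close> lies outside \<open>L\<close>, then \<open>a\<close> has a positive
  weight \<open>u\<close> in it. Since \<open>b\<close> is no farther from \<open>x\<close> than
  \<open>z\<close>, convexity of the norm forces \<open>a\<close> to be at least as far as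
  \<open>z\<close>.\<close>

lemma farthest_point_of_convex_hull_insert:
  fixes L :: "'b::real_normed_vector set"
  assumes L: "bounded L" "convex L" "L \<noteq> {}" and z: "z \<in> farthest_points (convex hull (insert a L))"
  shows "z \<in> L \<or> a \<in> farthest_points (convex hull (insert a L))"
proof -
  let ?K = "convex hull (insert a L)"
  obtain x where x: "z \<in> ?K" "norm (z - x) = farthest_radius ?K x"
    using z by (auto simp: farthest_points_def farthest_points_from_def)
  have bounded: "bounded ?K" using L(1) by (intro bounded_convex_hull) simp
  obtain u v b where uv: "u \<ge> 0" "v \<ge> 0" "u + v = 1" and b: "b \<in> L" and zeq: "z = u *\<^sub>R a + v *\<^sub>R b"
    using x(1) unfolding convex_hull_insert[OF L(3)] hull_same[of convex, OF L(2)] by blast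
  have aK: "a \<in> ?K" and bK: "b \<in> ?K" using b by (auto intro: hull_inc)
  show ?thesis
  proof (cases "u = 0")
    case True
    then show ?thesis using uv b zeq by simp
  next
    case False
    then have "u > 0" using uv by simp
    have "z - x = u *\<^sub>R (a - x) + v *\<^sub>R (b - x)"
      using uv(3) by (simp add: zeq algebra_simps flip: scaleR_add_left)
    then have "norm (z - x) \<le> u * norm (a - x) + v * norm (b - x)"
      using uv by (metis abs_of_nonneg norm_scaleR norm_triangle_ineq)
    also have "v * norm (b - x) \<le> v * norm (z - x)"
      using uv norm_le_farthest_radius[OF bounded bK, of x] x(2) by (intro mult_left_mono) auto
    finally have "(1 - v) * norm (z - x) \<le> u * norm (a - x)" by (simp add: algebra_simps)
    moreover have "1 - v = u" using uv by simp
    ultimately have "norm (z - x) \<le> norm (a - x)" using \<open>u > 0\<close> by simp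
    then have "a \<in> farthest_points_from ?K x"
      using norm_le_farthest_radius[OF bounded, of _ x] x(2) aK by (intro farthest_points_from_eq) fastforce+
    then show ?thesis by (auto simp: farthest_points_def)
  qed
qed

lemma farthest_points_generate_imp_weak_star_MIP:
  assumes gen: "\<And>K :: ('a::banach \<Rightarrow>\<^sub>L real) set. K \<noteq> {} \<Longrightarrow> compactin weak_star K \<Longrightarrow> convex K \<Longrightarrow>
      K = weak_star closure_of (convex hull (farthest_points K))"
  shows "weak_star_MIP TYPE('a)"
  unfolding weak_star_MIP_def
proof (intro allI impI)
  fix K :: "'a dual set"
  assume K: "K \<noteq> {}" "bounded K" "closedin weak_star K" "convex K"
  have compact: "compactin weak_star K" using K by (intro bounded_closedin_weak_star_imp_compactin)
  have "\<exists>x r. r > 0 \<and> K \<subseteq> cball x r \<and> a \<notin> cball x r" if a: "a \<notin> K" for a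
  proof -
    have "closed K" using K(3) by (rule closedin_weak_star_imp_closed)
    then obtain d where d: "d > 0" "ball a d \<subseteq> - K"
      using a openE[of "- K" a] by (auto simp: open_Compl)
    \<comment> \<open>Halving makes every distance from \<open>a\<close> to \<open>K\<close>
      strictly larger than \<open>e\<close>, so that \<open>a\<close> stays outside the thickened
      set.\<close>
    define e where "e = d / 2"
    have "d \<le> dist a k" if "k \<in> K" for k using d that by (auto simp: subset_iff not_less[symmetric])
    with d(1) have e: "e > 0" "\<And>k. k \<in> K \<Longrightarrow> e < dist a k" by (fastforce simp: e_def)+
    \<comment> \<open>thickening \<open>K\<close> turns ``\<open>a\<close> is a farthest point'' into strict separation by a ball\<close>
    define L where "L = (\<lambda>(k, u). k + u) ` (K \<times> cball 0 e)"
    have L: "compactin weak_star L" unfolding L_def using compact by (rule compactin_weak_star_plus_cball)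
    have "L = (\<Union>k\<in>K. \<Union>u\<in>cball 0 e. {k + u})" by (auto simp: L_def)
    then have "convex L" using convex_sums[OF K(4) convex_cball, of 0 e] by simp
    have LI: "k + u \<in> L" if "k \<in> K" "norm u \<le> e" for k u using that by (force simp: L_def)
    have "L \<noteq> {}" using K(1) e(1) by (auto simp: L_def)
    have "a \<notin> L" using e(2) by (force simp: L_def dist_norm)
    have bL: "bounded L" using L by (rule compactin_weak_star_imp_bounded)
    let ?H = "convex hull (insert a L)"
    have H: "compactin weak_star ?H"
      by (intro compactin_weak_star_convex_hull_insert L \<open>convex L\<close> \<open>L \<noteq> {}\<close>)
    have "a \<in> farthest_points ?H"
    proof (rule ccontr)
      assume "a \<notin> farthest_points ?H"
      then have "farthest_points ?H \<subseteq> L"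
        using farthest_point_of_convex_hull_insert[OF bL \<open>convex L\<close> \<open>L \<noteq> {}\<close>] by blast
      then have "convex hull (farthest_points ?H) \<subseteq> L" using \<open>convex L\<close> by (rule hull_minimal)
      then have "weak_star closure_of (convex hull (farthest_points ?H)) \<subseteq> L"
        using compactin_imp_closedin[OF Hausdorff_weak_star L] by (rule closure_of_minimal)
      moreover have "?H = weak_star closure_of (convex hull (farthest_points ?H))"
        using H by (intro gen) auto
      moreover have "a \<in> ?H" by (simp add: hull_inc)
      ultimately show False using \<open>a \<notin> L\<close> by blast
    qed
    then obtain x where x: "norm (a - x) = farthest_radius ?H x"
      by (auto simp: farthest_points_def farthest_points_from_def)
    have "norm (k - x) + e \<le> norm (a - x)" if k: "k \<in> K" for k
    proof -
      have le: "norm (y - x) \<le> norm (a - x)" if "y \<in> L" for y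
        unfolding x using that compactin_weak_star_imp_bounded[OF H]
        by (intro norm_le_farthest_radius) (auto intro: hull_inc)
      show ?thesis
      proof (cases "k = x")
        case True
        \<comment> \<open>No direction leads from \<open>x\<close> to \<open>k\<close> here; the
          choice of \<open>e\<close> gives the bound directly.\<close>
        then show ?thesis using e(2)[OF k] by (simp add: dist_norm)
      next
        case False
        \<comment> \<open>Pushes \<open>k\<close> away from \<open>x\<close> by \<open>e\<close>
          along the line through both, without leaving \<open>L\<close>.\<close>
        define u where "u = (e / norm (k - x)) *\<^sub>R (k - x)"
        have "norm u \<le> e" using e(1) False by (simp add: u_def)
        moreover have "norm (k + u - x) = norm (k - x) + e"
        proof -
          have "k + u - x = (1 + e / norm (k - x)) *\<^sub>R (k - x)" by (simp add: u_def algebra_simps)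
          also have "norm \<dots> = (1 + e / norm (k - x)) * norm (k - x)" using e(1) by simp
          also have "\<dots> = norm (k - x) + e" using False by (simp add: field_simps)
          finally show ?thesis .
        qed
        ultimately show ?thesis using le[OF LI[OF k]] by metis
      qed
    qed
    then have sub: "K \<subseteq> cball x (norm (a - x) - e)" by (force simp: dist_norm norm_minus_commute)
    \<comment> \<open>The inclusion above only shows that its radius is nonnegative, while
      admissibility asks for positive radii; enlarging by \<open>e / 2\<close> secures this and
      still excludes \<open>a\<close>.\<close>
    moreover have "cball x (norm (a - x) - e) \<subseteq> cball x (norm (a - x) - e / 2)" using e(1) by (intro subset_cball) simp
    moreover have "norm (a - x) - e / 2 > 0"
    proof -
      obtain k where "k \<in> K" using K(1) by blast
      then have "norm (a - x) - e \<ge> 0" using sub by (metis cball_eq_empty empty_iff not_le subsetD)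
      then show ?thesis using e(1) by simp
    qed
    moreover have "a \<notin> cball x (norm (a - x) - e / 2)" using e(1) by (simp add: dist_norm norm_minus_commute)
    ultimately show ?thesis by blast
  qed
  then show "admissible K" unfolding admissible_def by blast
qed

theorem theorem6:
  assumes "radon_nikodym_property TYPE('a::banach)"
  shows "weak_star_MIP TYPE('a) \<longleftrightarrow>
    (\<forall>K :: 'a dual set. K \<noteq> {} \<longrightarrow> compactin weak_star K \<longrightarrow> convex K \<longrightarrow>
       K = weak_star closure_of (convex hull (farthest_points K)))"
  using weak_star_MIP_imp_farthest_points_generate[OF assms] farthest_points_generate_imp_weak_star_MIP
  by blast

end
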